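(* Let $R$ be a commutative ring and let $X$ be a subset of $\operatorname{Spec}(R)$ with the property that for each maximal ideal $\mathfrak{m}$ of $R$ there exists some $\mathfrak{p}\in X$ such that $\mathfrak{p}\subseteq\mathfrak{m}$. If the collection of subsets $\{X\cap V(f): f\in R\}$ (ordered by inclusion) satisfies either the ascending chain condition or the descending chain condition, then $R$ is an S-ring.
   Context: All rings are commutative with identity. For $f\in R$, $V(f)=\{\mathfrak{p}\in\operatorname{Spec}(R): f\in\mathfrak{p}\}$. A ring $R$ is called an S-ring if every finitely generated flat $R$-module is a projective $R$-module. *)

theory Defs
  imports "HOL-Algebra.Algebra"
begin

definition Spec :: "('a, 'r) ring_scheme \<Rightarrow> 'a set set" where
  "Spec R = {P. primeideal P R}"

definition V :: "('a, 'r) ring_scheme \<Rightarrow> 'a \<Rightarrow> 'a set set" where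
  "V R f = {P \<in> Spec R. f \<in> P}"

definition acc :: "'b set set \<Rightarrow> bool" where
  "acc \<C> \<longleftrightarrow> (\<forall>A :: nat \<Rightarrow> 'b set. range A \<subseteq> \<C> \<and> incseq A \<longrightarrow> (\<exists>n. \<forall>k\<ge>n. A k = A n))"

definition dcc :: "'b set set \<Rightarrow> bool" where
  "dcc \<C> \<longleftrightarrow> (\<forall>A :: nat \<Rightarrow> 'b set. range A \<subseteq> \<C> \<and> decseq A \<longrightarrow> (\<exists>n. \<forall>k\<ge>n. A k = A n))"

definition fin_gen :: "('a, 'r) ring_scheme \<Rightarrow> ('a, 'm, 's) module_scheme \<Rightarrow> bool" where
  "fin_gen R M \<longleftrightarrow> (\<exists>S. finite S \<and> S \<subseteq> carrier M \<and>
     (\<forall>x \<in> carrier M. \<exists>c \<in> S \<rightarrow> carrier R. x = (\<Oplus>\<^bsub>M\<^esub>s\<in>S. c s \<odot>\<^bsub>M\<^esub> s)))"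

definition linear_maps ::
    "('a, 'r) ring_scheme \<Rightarrow> ('a, 'm, 's) module_scheme \<Rightarrow> ('a, 'n, 't) module_scheme \<Rightarrow> ('m \<Rightarrow> 'n) set"
  where "linear_maps R M N = {f \<in> carrier M \<rightarrow> carrier N.
    (\<forall>x \<in> carrier M. \<forall>y \<in> carrier M. f (x \<oplus>\<^bsub>M\<^esub> y) = f x \<oplus>\<^bsub>N\<^esub> f y) \<and>
    (\<forall>a \<in> carrier R. \<forall>x \<in> carrier M. f (a \<odot>\<^bsub>M\<^esub> x) = a \<odot>\<^bsub>N\<^esub> f x)}"

text \<open>The tensor product of two modules, as the quotient of the free abelian group on pairs by the
  bilinearity and balancing relations.  Only its additive group is recorded: that is all that
  injectivity of an induced map depends on.\<close>

definition tensor_rels ::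
    "('a, 'r) ring_scheme \<Rightarrow> ('a, 'n, 't) module_scheme \<Rightarrow> ('a, 'm, 's) module_scheme
      \<Rightarrow> ('n \<times> 'm \<Rightarrow>\<^sub>0 int) set"
  where "tensor_rels R N M =
    {frag_of (x \<oplus>\<^bsub>N\<^esub> y, m) - frag_of (x, m) - frag_of (y, m) | x y m.
       x \<in> carrier N \<and> y \<in> carrier N \<and> m \<in> carrier M} \<union>
    {frag_of (x, m \<oplus>\<^bsub>M\<^esub> m') - frag_of (x, m) - frag_of (x, m') | x m m'.
       x \<in> carrier N \<and> m \<in> carrier M \<and> m' \<in> carrier M} \<union>
    {frag_of (a \<odot>\<^bsub>N\<^esub> x, m) - frag_of (x, a \<odot>\<^bsub>M\<^esub> m) | a x m.
       a \<in> carrier R \<and> x \<in> carrier N \<and> m \<in> carrier M}"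

abbreviation tensor_free ::
    "('a, 'n, 't) module_scheme \<Rightarrow> ('a, 'm, 's) module_scheme \<Rightarrow> ('n \<times> 'm \<Rightarrow>\<^sub>0 int) monoid"
  where "tensor_free N M \<equiv> free_Abelian_group (carrier N \<times> carrier M)"

definition tensor_sub ::
    "('a, 'r) ring_scheme \<Rightarrow> ('a, 'n, 't) module_scheme \<Rightarrow> ('a, 'm, 's) module_scheme
      \<Rightarrow> ('n \<times> 'm \<Rightarrow>\<^sub>0 int) set"
  where "tensor_sub R N M = generate (tensor_free N M) (tensor_rels R N M)"

definition tensor ::
    "('a, 'r) ring_scheme \<Rightarrow> ('a, 'n, 't) module_scheme \<Rightarrow> ('a, 'm, 's) module_scheme
      \<Rightarrow> ('n \<times> 'm \<Rightarrow>\<^sub>0 int) set monoid"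
  where "tensor R N M = tensor_free N M Mod tensor_sub R N M"

definition pair_map :: "('k \<Rightarrow> 'n) \<Rightarrow> ('k \<times> 'm \<Rightarrow>\<^sub>0 int) \<Rightarrow> ('n \<times> 'm \<Rightarrow>\<^sub>0 int)" where
  "pair_map f = frag_extend (\<lambda>(x, m). frag_of (f x, m))"

text \<open>For linear \<open>f\<close> from \<open>K\<close> to \<open>N\<close>, the map \<open>f \<otimes> id\<close> from \<open>K \<otimes> M\<close> to \<open>N \<otimes> M\<close>; lemma
  \<open>tensor_map_coset\<close> below shows that the image of a coset does not depend on representatives.\<close>

definition tensor_map ::
    "('a, 'r) ring_scheme \<Rightarrow> ('a, 'n, 't) module_scheme \<Rightarrow> ('a, 'm, 's) module_scheme
      \<Rightarrow> ('k \<Rightarrow> 'n) \<Rightarrow> ('k \<times> 'm \<Rightarrow>\<^sub>0 int) set \<Rightarrow> ('n \<times> 'm \<Rightarrow>\<^sub>0 int) set"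
  where "tensor_map R N M f C =
    the_elem ((\<lambda>u. tensor_sub R N M #>\<^bsub>tensor_free N M\<^esub> pair_map f u) ` C)"

text \<open>\<open>flat TYPE('k) R M\<close>: tensoring with \<open>M\<close> preserves injectivity of linear maps \<open>K \<rightarrow> N\<close>.
  HOL cannot quantify over types inside a definition, so the type of the elements of the test
  modules \<open>K\<close>, \<open>N\<close> is a parameter; likewise in \<open>projective\<close>.\<close>

definition flat :: "'k itself \<Rightarrow> ('a, 'r) ring_scheme \<Rightarrow> ('a, 'm, 's) module_scheme \<Rightarrow> bool" where
  "flat (_ :: 'k itself) R M \<longleftrightarrow> module R M \<and>
     (\<forall>(K :: ('a, 'k) module) (N :: ('a, 'k) module) f.
        module R K \<and> module R N \<and> f \<in> linear_maps R K N \<and> inj_on f (carrier K)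
        \<longrightarrow> inj_on (tensor_map R N M f) (carrier (tensor R K M)))"

definition projective :: "'n itself \<Rightarrow> ('a, 'r) ring_scheme \<Rightarrow> ('a, 'm, 's) module_scheme \<Rightarrow> bool" where
  "projective (_ :: 'n itself) R M \<longleftrightarrow> module R M \<and>
     (\<forall>(E :: ('a, 'n) module) (N :: ('a, 'n) module) g f.
        module R E \<and> module R N \<and> g \<in> linear_maps R E N \<and> g ` carrier E = carrier N \<and>
        f \<in> linear_maps R M N
        \<longrightarrow> (\<exists>h \<in> linear_maps R M E. \<forall>x \<in> carrier M. g (h x) = f x))"

text \<open>Every finitely generated flat \<open>R\<close>-module with elements in \<open>'m\<close> is projective, projectivity being
  tested on modules with elements in \<open>'n\<close>.  For \<open>R\<close> to be an S-ring means that this holds for all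
  types \<open>'m\<close> and \<open>'n\<close>, so a theorem should leave both type variables free.
  Flatness, in contrast, occurs as a hypothesis and is tested on one fixed type, \<open>'a list set\<close>.
  That is enough to give flatness with respect to modules of every type: injectivity of
  \<open>K \<otimes> M \<rightarrow> N \<otimes> M\<close> can be checked on finitely generated \<open>K\<close> and \<open>N\<close>, and every finitely
  generated module has an isomorphic copy whose elements are sets of coordinate lists (the cosets
  in a quotient of a free module of finite rank).\<close>

definition S_ring :: "'m itself \<Rightarrow> 'n itself \<Rightarrow> ('a, 'r) ring_scheme \<Rightarrow> bool" where
  "S_ring (_ :: 'm itself) (_ :: 'n itself) R \<longleftrightarrow> cring R \<and>
     (\<forall>M :: ('a, 'm) module. module R M \<and> fin_gen R M \<and> flat TYPE('a list set) R M
        \<longrightarrow> projective TYPE('n) R M)"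

lemma tensor_rels_closed:
  assumes "module R N" "module R M"
  shows "tensor_rels R N M \<subseteq> carrier (tensor_free N M)"
proof -
  interpret N: module R N by fact
  interpret M: module R M by fact
  have *: "frag_of a - frag_of b \<in> carrier (tensor_free N M)"
    if "a \<in> carrier N \<times> carrier M" "b \<in> carrier N \<times> carrier M" for a b
    using that keys_diff[of "frag_of a" "frag_of b"] by auto
  have **: "frag_of a - frag_of b - frag_of c \<in> carrier (tensor_free N M)"
    if "a \<in> carrier N \<times> carrier M" "b \<in> carrier N \<times> carrier M" "c \<in> carrier N \<times> carrier M"
    for a b c
    using that *[of a b] keys_diff[of "frag_of a - frag_of b" "frag_of c"] by auto
  show ?thesis
    unfolding tensor_rels_def
    by (intro Un_least subsetI; elim CollectE exE conjE; hypsubst; (rule ** | rule *); simp)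
qed

lemma tensor_sub_normal:
  assumes "module R N" "module R M"
  shows "tensor_sub R N M \<lhd> tensor_free N M"
  unfolding tensor_sub_def
  by (intro comm_group.subgroup_imp_normal group.generate_is_subgroup
      abelian_free_Abelian_group group_free_Abelian_group tensor_rels_closed assms)

lemma pair_map_diff: "pair_map f (u - v) = pair_map f u - pair_map f v"
  by (simp add: pair_map_def frag_extend_diff)

lemma pair_map_add: "pair_map f (u + v) = pair_map f u + pair_map f v"
  by (simp add: pair_map_def frag_extend_add)

lemma pair_map_of: "pair_map f (frag_of (x, m)) = frag_of (f x, m)"
  by (simp add: pair_map_def)

lemma pair_map_closed:
  assumes "f \<in> carrier K \<rightarrow> carrier N" "u \<in> carrier (tensor_free K M)"
  shows "pair_map f u \<in> carrier (tensor_free N M)"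
proof -
  have "Poly_Mapping.keys (pair_map f u)
      \<subseteq> (\<Union>p \<in> Poly_Mapping.keys u. Poly_Mapping.keys (case p of (x, m) \<Rightarrow> frag_of (f x, m)))"
    unfolding pair_map_def by (rule keys_frag_extend)
  also have "\<dots> \<subseteq> carrier N \<times> carrier M"
    using assms by fastforce
  finally show ?thesis by simp
qed

lemma pair_map_rels:
  assumes "f \<in> linear_maps R K N" "u \<in> tensor_rels R K M"
  shows "pair_map f u \<in> tensor_rels R N M"
proof -
  have f: "f x \<in> carrier N" if "x \<in> carrier K" for x
    using assms(1) that by (auto simp: linear_maps_def)
  from assms(2) consider
      (add_left) x y m where "u = frag_of (x \<oplus>\<^bsub>K\<^esub> y, m) - frag_of (x, m) - frag_of (y, m)"
        "x \<in> carrier K" "y \<in> carrier K" "m \<in> carrier M"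
    | (add_right) x m m' where "u = frag_of (x, m \<oplus>\<^bsub>M\<^esub> m') - frag_of (x, m) - frag_of (x, m')"
        "x \<in> carrier K" "m \<in> carrier M" "m' \<in> carrier M"
    | (smult) a x m where "u = frag_of (a \<odot>\<^bsub>K\<^esub> x, m) - frag_of (x, a \<odot>\<^bsub>M\<^esub> m)"
        "a \<in> carrier R" "x \<in> carrier K" "m \<in> carrier M"
    unfolding tensor_rels_def by blast
  then show ?thesis
  proof cases
    case add_left
    then have "pair_map f u = frag_of (f x \<oplus>\<^bsub>N\<^esub> f y, m) - frag_of (f x, m) - frag_of (f y, m)"
      using assms(1) by (simp add: linear_maps_def pair_map_diff pair_map_of)
    then show ?thesis
      using add_left f unfolding tensor_rels_def by blast
  next
    case add_right
    then have "pair_map f u = frag_of (f x, m \<oplus>\<^bsub>M\<^esub> m') - frag_of (f x, m) - frag_of (f x, m')"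
      by (simp add: pair_map_diff pair_map_of)
    then show ?thesis
      using add_right f unfolding tensor_rels_def by blast
  next
    case smult
    then have "pair_map f u = frag_of (a \<odot>\<^bsub>N\<^esub> f x, m) - frag_of (f x, a \<odot>\<^bsub>M\<^esub> m)"
      using assms(1) by (simp add: linear_maps_def pair_map_diff pair_map_of)
    then show ?thesis
      using smult f unfolding tensor_rels_def by blast
  qed
qed

lemma pair_map_sub:
  assumes "f \<in> linear_maps R K N" "module R K" "module R N" "module R M" "u \<in> tensor_sub R K M"
  shows "pair_map f u \<in> tensor_sub R N M"
proof -
  have hom: "pair_map f \<in> hom (tensor_free K M) (tensor_free N M)"
    using assms(1) by (intro homI pair_map_closed) (auto simp: linear_maps_def pair_map_add)
  have "pair_map f ` generate (tensor_free K M) (tensor_rels R K M)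
      = generate (tensor_free N M) (pair_map f ` tensor_rels R K M)"
    by (intro group_hom.generate_img[symmetric] group_hom.intro group_hom_axioms.intro hom
        group_free_Abelian_group tensor_rels_closed assms)
  also have "\<dots> \<subseteq> generate (tensor_free N M) (tensor_rels R N M)"
    using pair_map_rels[OF assms(1)] by (intro group.mono_generate group_free_Abelian_group) auto
  finally show ?thesis
    using assms(5) unfolding tensor_sub_def by blast
qed

lemma tensor_map_coset:
  assumes f: "f \<in> linear_maps R K N" and mods: "module R K" "module R N" "module R M"
    and u: "u \<in> carrier (tensor_free K M)"
  shows "tensor_map R N M f (tensor_sub R K M #>\<^bsub>tensor_free K M\<^esub> u)
       = tensor_sub R N M #>\<^bsub>tensor_free N M\<^esub> pair_map f u"
proof -
  interpret FK: normal "tensor_sub R K M" "tensor_free K M"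
    by (rule tensor_sub_normal) fact+
  interpret FN: normal "tensor_sub R N M" "tensor_free N M"
    by (rule tensor_sub_normal) fact+
  have fc: "f \<in> carrier K \<rightarrow> carrier N"
    using f by (simp add: linear_maps_def)
  have eq: "tensor_sub R N M #>\<^bsub>tensor_free N M\<^esub> pair_map f v
      = tensor_sub R N M #>\<^bsub>tensor_free N M\<^esub> pair_map f u"
    if v: "v \<in> tensor_sub R K M #>\<^bsub>tensor_free K M\<^esub> u" for v
  proof -
    obtain t where t: "t \<in> tensor_sub R K M" "v = t + u"
      using v by (auto simp: r_coset_def)
    have "pair_map f v \<in> tensor_sub R N M #>\<^bsub>tensor_free N M\<^esub> pair_map f u"
      using pair_map_sub[OF f mods t(1)] t(2) by (auto simp: r_coset_def pair_map_add)
    then show ?thesis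
      using FN.repr_independence[OF _ pair_map_closed[OF fc u] FN.subgroup_axioms] by simp
  qed
  have "u \<in> tensor_sub R K M #>\<^bsub>tensor_free K M\<^esub> u"
    using FK.rcos_self[OF u FK.subgroup_axioms] .
  then have "(\<lambda>v. tensor_sub R N M #>\<^bsub>tensor_free N M\<^esub> pair_map f v) `
      (tensor_sub R K M #>\<^bsub>tensor_free K M\<^esub> u)
      = {tensor_sub R N M #>\<^bsub>tensor_free N M\<^esub> pair_map f u}"
    using eq by blast
  then show ?thesis
    by (simp add: tensor_map_def)
qed

end

theory Submission
  imports Defs
begin

text \<open>Write a finitely generated flat module as \<open>R\<^sup>S / K\<close> with \<open>S\<close> finite. Flatness means that every
  relation in \<open>K\<close> is fixed by some matrix with rows in \<open>K\<close>, and projectivity that one such matrix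
  fixes all of \<open>K\<close>. Instead of minors and exterior powers, use frames: families of \<open>r\<close> relations
  that are \<open>t\<close> times the identity matrix on \<open>r\<close> coordinates. The ideal \<open>J\<^sub>r\<close> generated by these
  values \<open>t\<close> plays the role of a Fitting ideal: it cuts out the maximal ideals at which \<open>K\<close> has rank
  less than \<open>r\<close>, and its elements are nilpotent locally there. Were this closed set not open, one
  could choose \<open>f\<^sub>0, f\<^sub>1, \<dots>\<close> in \<open>J\<^sub>r\<close> with \<open>f\<^sub>i (1 - f\<^sub>i\<^sub>+\<^sub>1)\<close> in every prime of \<open>Y\<close> for which neither
  \<open>Y \<inter> V(1 - f\<^sub>i)\<close> nor \<open>Y \<inter> V(f\<^sub>i)\<close> becomes stationary. So the rank is locally constant, which gives
  finitely many relations generating \<open>K\<close> locally at every maximal ideal, and a matrix fixing these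
  fixes \<open>K\<close>.\<close>

section \<open>Sums, ideals and localness\<close>

text \<open>Over a local ring finitely generated flat modules are free, so only the variation of the
  rank from one maximal ideal to another can obstruct projectivity. One direction is automatic: a
  frame whose value avoids \<open>m\<close> does so nearby as well, hence the rank of
  \<open>K\<close> can only jump up near \<open>m\<close>. The chain condition must forbid these
  jumps. It sees an element only through the primes of \<open>Y\<close> containing it, so it cannot
  tell an element lying in all of them from zero. For this reason no more than nilpotence is asked
  of the elements of \<open>J\<^sub>r\<close>, and no idempotent of \<open>R\<close> is constructed:
  it is enough to find \<open>f\<close> in \<open>J\<^sub>r\<close> such that every maximal ideal
  contains \<open>J\<^sub>r\<close> or \<open>1 - f\<close>, because all gluing takes place at
  maximal ideals. The adjugate of an r x r block of relations turns the block into its minor times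
  the identity; this is where frames come from, with \<open>t\<close> as the minor. Frames can also
  be enlarged by a single elimination step, and elimination likewise replaces determinants in
  Nakayama's lemma and in the comparison of ranks.\<close>

lemma (in abelian_monoid) finsum_swap:
  assumes "finite A" "finite B" "\<And>i j. i \<in> A \<Longrightarrow> j \<in> B \<Longrightarrow> f i j \<in> carrier G"
  shows "(\<Oplus>i\<in>A. \<Oplus>j\<in>B. f i j) = (\<Oplus>j\<in>B. \<Oplus>i\<in>A. f i j)"
  using assms(1,3)
proof (induction A rule: finite_induct)
  case empty
  then show ?case by (simp add: finsum_zero)
next
  case (insert x A)
  have "(\<Oplus>j\<in>B. \<Oplus>i\<in>insert x A. f i j) = (\<Oplus>j\<in>B. f x j \<oplus> (\<Oplus>i\<in>A. f i j))"
    using insert by (intro finsum_cong') (auto simp: finsum_insert Pi_iff)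
  also have "\<dots> = (\<Oplus>j\<in>B. f x j) \<oplus> (\<Oplus>j\<in>B. \<Oplus>i\<in>A. f i j)"
    using insert by (intro finsum_addf) (auto simp: Pi_iff)
  also have "\<dots> = (\<Oplus>i\<in>insert x A. \<Oplus>j\<in>B. f i j)"
    using insert by (subst finsum_insert) (auto simp: Pi_iff)
  finally show ?case by simp
qed

context cring
begin

lemma idealI_submodule:
  assumes "I \<subseteq> carrier R" "\<zero> \<in> I" "\<And>a b. a \<in> I \<Longrightarrow> b \<in> I \<Longrightarrow> a \<oplus> b \<in> I"
    and smult: "\<And>a x. a \<in> I \<Longrightarrow> x \<in> carrier R \<Longrightarrow> x \<otimes> a \<in> I"
  shows "ideal I R"
proof (rule idealI[OF ring_axioms])
  have "\<ominus> a \<in> I" if "a \<in> I" for a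
    using smult[OF that, of "\<ominus> \<one>"] that assms(1) by (auto simp: l_minus)
  then show "subgroup I (add_monoid R)"
    using assms by (intro add.subgroupI) (auto simp: a_inv_def)
  show "a \<otimes> x \<in> I" if "a \<in> I" "x \<in> carrier R" for a x
    using smult[OF that] that assms(1) by (metis m_comm subsetD)
qed (use smult in auto)

lemma ideal_finsum_closed:
  assumes "ideal I R" "finite A" "\<And>i. i \<in> A \<Longrightarrow> f i \<in> I"
  shows "(\<Oplus>i\<in>A. f i) \<in> I"
proof -
  interpret ideal I R by fact
  show ?thesis
    using assms(2,3)
  proof (induction A rule: finite_induct)
    case (insert x A)
    then show ?case
      by (subst finsum_insert) (auto intro: a_Hcarr)
  qed simp
qed

text \<open>The ideal generated by the \<open>r s\<close>, kept in a form from which coefficients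
  can be chosen for its elements.\<close>

lemma ideal_linear_combinations:
  assumes "finite S" "\<And>s. s \<in> S \<Longrightarrow> r s \<in> carrier R"
  shows "ideal {\<Oplus>s\<in>S. r s \<otimes> c s | c. c \<in> S \<rightarrow> carrier R} R"
proof (rule idealI_submodule)
  show "{\<Oplus>s\<in>S. r s \<otimes> c s |c. c \<in> S \<rightarrow> carrier R} \<subseteq> carrier R"
    using assms by (auto intro!: finsum_closed)
  have "(\<Oplus>s\<in>S. r s \<otimes> \<zero>) = (\<Oplus>s\<in>S. \<zero>)"
    using assms by (intro finsum_cong') auto
  then show "\<zero> \<in> {\<Oplus>s\<in>S. r s \<otimes> c s |c. c \<in> S \<rightarrow> carrier R}"
    by (intro CollectI exI[of _ "\<lambda>_. \<zero>"]) (simp add: finsum_zero)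
  show "a \<oplus> b \<in> {\<Oplus>s\<in>S. r s \<otimes> c s |c. c \<in> S \<rightarrow> carrier R}"
    if a: "a \<in> {\<Oplus>s\<in>S. r s \<otimes> c s |c. c \<in> S \<rightarrow> carrier R}"
      and b: "b \<in> {\<Oplus>s\<in>S. r s \<otimes> c s |c. c \<in> S \<rightarrow> carrier R}" for a b
  proof -
    obtain c d where c: "c \<in> S \<rightarrow> carrier R" "a = (\<Oplus>s\<in>S. r s \<otimes> c s)"
      and d: "d \<in> S \<rightarrow> carrier R" "b = (\<Oplus>s\<in>S. r s \<otimes> d s)" using a b by blast
    have "(\<Oplus>s\<in>S. r s \<otimes> (c s \<oplus> d s)) = (\<Oplus>s\<in>S. r s \<otimes> c s \<oplus> r s \<otimes> d s)"
      using assms c d by (intro finsum_cong') (auto simp: r_distr Pi_iff)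
    also have "\<dots> = a \<oplus> b"
      using assms c d by (simp add: finsum_addf Pi_iff)
    finally show ?thesis
      using c d by (intro CollectI exI[of _ "\<lambda>s. c s \<oplus> d s"]) (auto simp: Pi_iff)
  qed
  show "x \<otimes> a \<in> {\<Oplus>s\<in>S. r s \<otimes> c s |c. c \<in> S \<rightarrow> carrier R}"
    if a: "a \<in> {\<Oplus>s\<in>S. r s \<otimes> c s |c. c \<in> S \<rightarrow> carrier R}" and x: "x \<in> carrier R" for a x
  proof -
    obtain c where c: "c \<in> S \<rightarrow> carrier R" "a = (\<Oplus>s\<in>S. r s \<otimes> c s)" using a by blast
    have "(\<Oplus>s\<in>S. r s \<otimes> (x \<otimes> c s)) = (\<Oplus>s\<in>S. x \<otimes> (r s \<otimes> c s))"
      using assms c x by (intro finsum_cong') (auto simp: m_lcomm Pi_iff)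
    also have "\<dots> = x \<otimes> a"
      using assms c x by (simp add: finsum_rdistr Pi_iff)
    finally show ?thesis
      using c x by (intro CollectI exI[of _ "\<lambda>s. x \<otimes> c s"]) (auto simp: Pi_iff)
  qed
qed

lemma finsum_mult_minus:
  assumes "finite S" "\<And>s. s \<in> S \<Longrightarrow> r s \<in> carrier R" "\<And>s. s \<in> S \<Longrightarrow> k s \<in> carrier R"
    "\<And>s. s \<in> S \<Longrightarrow> l s \<in> carrier R"
  shows "(\<Oplus>s\<in>S. r s \<otimes> (k s \<ominus> l s)) = (\<Oplus>s\<in>S. r s \<otimes> k s) \<ominus> (\<Oplus>s\<in>S. r s \<otimes> l s)"
proof -
  have "(\<Oplus>s\<in>S. r s \<otimes> (k s \<ominus> l s)) = (\<Oplus>s\<in>S. r s \<otimes> k s \<oplus> (\<ominus> \<one>) \<otimes> (r s \<otimes> l s))"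
    using assms by (intro finsum_cong') (auto simp: minus_eq l_minus r_minus r_distr)
  also have "\<dots> = (\<Oplus>s\<in>S. r s \<otimes> k s) \<oplus> (\<ominus> \<one>) \<otimes> (\<Oplus>s\<in>S. r s \<otimes> l s)"
    using assms by (simp add: finsum_addf finsum_rdistr Pi_iff)
  also have "\<dots> = (\<Oplus>s\<in>S. r s \<otimes> k s) \<ominus> (\<Oplus>s\<in>S. r s \<otimes> l s)"
    using assms by (simp add: l_minus minus_eq finsum_closed Pi_iff)
  finally show ?thesis .
qed

text \<open>Zorn's lemma applies to the ideals above \<open>I\<close> that avoid \<one>, because
  avoiding \<one> survives unions of chains.\<close>

lemma exists_maximalideal:
  assumes "ideal I R" "\<one> \<notin> I"
  shows "\<exists>m. maximalideal m R \<and> I \<subseteq> m"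
proof -
  define \<A> where "\<A> = {J. ideal J R \<and> I \<subseteq> J \<and> \<one> \<notin> J}"
  have "\<exists>m\<in>\<A>. \<forall>J\<in>\<A>. m \<subseteq> J \<longrightarrow> J = m"
  proof (rule subset_Zorn_nonempty)
    show "\<A> \<noteq> {}" using assms by (auto simp: \<A>_def)
    fix \<C> assume \<C>: "\<C> \<noteq> {}" "subset.chain \<A> \<C>"
    then have ideals: "ideal J R" if "J \<in> \<C>" for J
      using that by (auto simp: subset.chain_def \<A>_def)
    obtain J0 where "J0 \<in> \<C>" using \<C>(1) by blast
    have "ideal (\<Union>\<C>) R"
    proof (rule idealI_submodule)
      show "\<Union>\<C> \<subseteq> carrier R"
        using ideals by (meson Union_least additive_subgroup.a_subset ideal.axioms(1))
      show "\<zero> \<in> \<Union>\<C>"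
        using \<open>J0 \<in> \<C>\<close> ideals by (meson UnionI additive_subgroup.zero_closed ideal.axioms(1))
      show "x \<otimes> a \<in> \<Union>\<C>" if "a \<in> \<Union>\<C>" "x \<in> carrier R" for a x
        using that ideals by (meson UnionE UnionI ideal.I_l_closed)
      show "a \<oplus> b \<in> \<Union>\<C>" if ab: "a \<in> \<Union>\<C>" "b \<in> \<Union>\<C>" for a b
      proof -
        obtain J J' where JJ: "J \<in> \<C>" "a \<in> J" "J' \<in> \<C>" "b \<in> J'" using ab by blast
        have "J \<subseteq> J' \<or> J' \<subseteq> J"
          using \<C>(2) \<open>J \<in> \<C>\<close> \<open>J' \<in> \<C>\<close> unfolding subset.chain_def by blast
        then obtain L where "L \<in> \<C>" "a \<in> L" "b \<in> L" using JJ by blast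
        then show ?thesis
          using ideals by (meson UnionI additive_subgroup.a_closed ideal.axioms(1))
      qed
    qed
    then show "\<Union>\<C> \<in> \<A>"
      using \<C> \<open>J0 \<in> \<C>\<close> by (auto simp: \<A>_def subset.chain_def)
  qed
  then obtain m where m: "m \<in> \<A>" "\<And>J. J \<in> \<A> \<Longrightarrow> m \<subseteq> J \<Longrightarrow> J = m" by blast
  have "maximalideal m R"
  proof (rule maximalidealI)
    show "ideal m R" "carrier R \<noteq> m" using m(1) by (auto simp: \<A>_def)
    fix J assume J: "ideal J R" "m \<subseteq> J" "J \<subseteq> carrier R"
    show "J = m \<or> J = carrier R"
    proof (cases "\<one> \<in> J")
      case True
      then show ?thesis using J ideal.one_imp_carrier by blast
    next
      case False
      then show ?thesis using m J by (auto simp: \<A>_def)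
    qed
  qed
  then show ?thesis using m(1) by (auto simp: \<A>_def)
qed

text \<open>The gluing device: the scalars that make a statement true form an ideal, and once this
  ideal leaves every maximal ideal the statement holds for \<one>.\<close>

lemma one_mem_ideal_if_local:
  assumes "ideal I R" "\<And>m. maximalideal m R \<Longrightarrow> \<exists>u\<in>I. u \<notin> m"
  shows "\<one> \<in> I"
  using exists_maximalideal[OF assms(1)] assms(2) by blast

text \<open>Clearing denominators: finitely many statements that survive multiplication share the
  product of their multipliers, which stays outside the prime.\<close>

lemma prime_common_multiplier:
  assumes "primeideal m R" "finite A"
    and "\<And>a. a \<in> A \<Longrightarrow> \<exists>u\<in>carrier R - m. P a u"
    and mono: "\<And>a u v. a \<in> A \<Longrightarrow> u \<in> carrier R \<Longrightarrow> v \<in> carrier R \<Longrightarrow> P a u \<Longrightarrow> P a (v \<otimes> u)"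
  shows "\<exists>u\<in>carrier R - m. \<forall>a\<in>A. P a u"
  using assms(2-4)
proof (induction A rule: finite_induct)
  case empty
  then show ?case
    using primeideal.I_notcarr[OF assms(1)] ideal.one_imp_carrier[OF primeideal.axioms(1)[OF assms(1)]]
    by auto
next
  case (insert x A)
  obtain u where u: "u \<in> carrier R - m" "\<forall>a\<in>A. P a u"
    using insert by auto
  obtain v where v: "v \<in> carrier R - m" "P x v"
    using insert by blast
  have "v \<otimes> u \<in> carrier R - m"
    using u v primeideal.I_prime[OF assms(1)] by auto
  moreover have "P a (v \<otimes> u)" if "a \<in> insert x A" for a
    using that u v insert.prems(2)[of a u v] insert.prems(2)[of x v u] by (auto simp: m_comm)
  ultimately show ?case by blast
qed

lemma prime_mult_notin:
  assumes "primeideal p R" "a \<in> carrier R - p" "b \<in> carrier R - p"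
  shows "a \<otimes> b \<in> carrier R - p"
  using assms primeideal.I_prime by fastforce

lemma prime_one_notin: "primeideal p R \<Longrightarrow> \<one> \<in> carrier R - p"
  using primeideal.I_notcarr ideal.one_imp_carrier primeideal.axioms(1) by blast

lemma ideal_minus_mem_iff:
  assumes "ideal I R" "a \<in> carrier R" "b \<in> I"
  shows "a \<ominus> b \<in> I \<longleftrightarrow> a \<in> I"
proof -
  interpret ideal I R by fact
  have "a = (a \<ominus> b) \<oplus> b" using assms a_Hcarr[of b] by algebra
  then have "a \<in> I" if "a \<ominus> b \<in> I"
    using a_closed[OF that assms(3)] by simp
  moreover have "a \<ominus> b \<in> I" if "a \<in> I"
    using that assms(3) by (simp add: minus_eq)
  ultimately show ?thesis by blast
qed

end

section \<open>Openness from the chain condition\<close>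

lemma (in cring) comaximal_if_local:
  assumes I: "ideal I R" and J: "ideal J R"
    and local: "\<And>m. maximalideal m R \<Longrightarrow> \<exists>u\<in>I \<union> J. u \<notin> m"
  shows "\<exists>a\<in>I. \<exists>b\<in>J. \<one> = a \<oplus> b"
proof -
  interpret I: ideal I R by fact
  interpret J: ideal J R by fact
  have "\<one> \<in> I <+> J"
  proof (rule one_mem_ideal_if_local)
    show "ideal (I <+> J) R" by (rule add_ideals[OF I J])
    fix m assume "maximalideal m R"
    then obtain u where u: "u \<in> I \<union> J" "u \<notin> m" using local by blast
    have carr: "u \<in> carrier R" using u(1) I.a_Hcarr J.a_Hcarr by (elim UnE)
    have "\<exists>a\<in>I. \<exists>b\<in>J. u = a \<oplus> b"
    proof (cases "u \<in> I")
      case True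
      have "u = u \<oplus> \<zero>" using carr by simp
      then show ?thesis using True J.zero_closed by (intro bexI)
    next
      case False
      have "u = \<zero> \<oplus> u" using carr by simp
      then show ?thesis using False u(1) I.zero_closed by (intro bexI[of _ \<zero>] bexI[of _ u]) simp_all
    qed
    then show "\<exists>u\<in>I <+> J. u \<notin> m" using u(2) unfolding set_add_def' by (intro bexI[of _ u]) simp_all
  qed
  then show ?thesis unfolding set_add_def' by blast
qed

text \<open>The two alternatives of the conclusion exclude each other, since
  \<open>J \<subseteq> m\<close> puts \<open>f\<close> into \<open>m\<close>. So among maximal
  ideals the complement of V(J) is itself closed, cut out by \<open>\<one> \<ominus> f\<close>. Each
  \<open>f\<close> in \<open>J\<close> that fails to achieve this has a successor \<open>h\<close>
  for which this closed set, taken in \<open>Y\<close>, is strictly larger.\<close>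

lemma (in cring) clopen_approximation:
  assumes Y: "Y \<subseteq> Spec R" "\<And>m. maximalideal m R \<Longrightarrow> \<exists>p\<in>Y. p \<subseteq> m"
    and chain: "acc {Y \<inter> V R f | f. f \<in> carrier R} \<or> dcc {Y \<inter> V R f | f. f \<in> carrier R}"
    and J: "ideal J R"
    and vanish: "\<And>m f. maximalideal m R \<Longrightarrow> J \<subseteq> m \<Longrightarrow> f \<in> J \<Longrightarrow> \<exists>u\<in>carrier R - m. \<forall>p\<in>Y. u \<otimes> f \<in> p"
  shows "\<exists>f\<in>J. \<forall>m. maximalideal m R \<longrightarrow> J \<subseteq> m \<or> \<one> \<ominus> f \<in> m"
proof (rule ccontr)
  assume contra: "\<not> ?thesis"
  interpret J: ideal J R by fact
  have prime: "primeideal p R" if "p \<in> Y" for p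
    using that Y(1) by (auto simp: Spec_def)
  have Yideal: "ideal p R" if "p \<in> Y" for p
    using prime[OF that] by (rule primeideal.axioms(1))
  have one_minus: "\<one> \<ominus> f \<notin> p" if "f \<in> p" "p \<in> Y" for f p
  proof
    assume "\<one> \<ominus> f \<in> p"
    moreover have "f \<in> carrier R" using that Yideal ideal.Icarr by metis
    ultimately have "\<one> \<in> p"
      using ideal_minus_mem_iff[OF Yideal[OF that(2)] one_closed that(1)] by simp
    then show False using prime_one_notin[OF prime[OF that(2)]] by simp
  qed
  have step: "\<exists>h\<in>J. (\<forall>p\<in>Y. f \<in> p \<or> \<one> \<ominus> h \<in> p) \<and> (\<exists>p\<in>Y. \<one> \<ominus> f \<notin> p \<and> \<one> \<ominus> h \<in> p)"
    if f: "f \<in> J" for f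
  proof -
    obtain m where m: "maximalideal m R" "\<not> J \<subseteq> m" "\<one> \<ominus> f \<notin> m"
      using contra f by blast
    \<comment> \<open>\<open>g\<close> records that \<open>J\<close> is not inside \<open>m\<close>.
      Treating it together with \<open>f\<close> forces the new set
      \<open>Y \<inter> V R (\<one> \<ominus> h)\<close> to contain a prime that the old one
      misses.\<close>
    then obtain g where g: "g \<in> J" "g \<notin> m" by blast
    have fg: "f \<in> carrier R" "g \<in> carrier R" using f g by (auto intro: J.a_Hcarr)
    \<comment> \<open>Elements that kill \<open>f\<close> and \<open>g\<close> modulo all primes of
      \<open>Y\<close>. At a maximal ideal above \<open>J\<close> the assumption
      \<open>vanish\<close> supplies one outside that ideal; at the others \<open>J\<close> itself
      escapes. So \<open>Q\<close> and \<open>J\<close> are comaximal, and splitting \<one> yields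
      \<open>h\<close> with \<open>\<one> \<ominus> h\<close> in \<open>Q\<close>.\<close>
    define Q where "Q = {x \<in> carrier R. \<forall>p\<in>Y. x \<otimes> f \<in> p \<and> x \<otimes> g \<in> p}"
    have Q: "ideal Q R"
    proof (rule idealI_submodule)
      show "\<zero> \<in> Q"
        using fg Yideal by (auto simp: Q_def intro: additive_subgroup.zero_closed ideal.axioms(1))
      show "a \<oplus> b \<in> Q" if "a \<in> Q" "b \<in> Q" for a b
        using that fg Yideal
        by (auto simp: Q_def l_distr intro!: additive_subgroup.a_closed ideal.axioms(1))
      show "x \<otimes> a \<in> Q" if "a \<in> Q" "x \<in> carrier R" for a x
        using that fg Yideal 
        by (auto simp: Q_def m_assoc intro!: ideal.I_l_closed[of _ R "a \<otimes> f"] ideal.I_l_closed[of _ R "a \<otimes> g"])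
    qed (auto simp: Q_def)
    have "\<exists>q\<in>Q. \<exists>h\<in>J. \<one> = q \<oplus> h"
    proof (rule comaximal_if_local[OF Q J])
      fix n assume n: "maximalideal n R"
      show "\<exists>u\<in>Q \<union> J. u \<notin> n"
      proof (cases "J \<subseteq> n")
        case True
        have n': "primeideal n R" using n by (rule maximalideal_prime)
        obtain u where u: "u \<in> carrier R - n" "\<forall>p\<in>Y. u \<otimes> f \<in> p" using vanish[OF n True f] by blast
        obtain v where v: "v \<in> carrier R - n" "\<forall>p\<in>Y. v \<otimes> g \<in> p" using vanish[OF n True g(1)] by blast
        have "u \<otimes> v \<otimes> f \<in> p \<and> u \<otimes> v \<otimes> g \<in> p" if p: "p \<in> Y" for p
        proof -
          have "u \<otimes> v \<otimes> f = v \<otimes> (u \<otimes> f)" "u \<otimes> v \<otimes> g = u \<otimes> (v \<otimes> g)"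
            using u(1) v(1) fg by (auto simp: m_ac)
          then show ?thesis
            using ideal.I_l_closed[OF Yideal[OF p], of "u \<otimes> f" v] ideal.I_l_closed[OF Yideal[OF p], of "v \<otimes> g" u]
              u v p by simp
        qed
        then have "u \<otimes> v \<in> Q"
          using u(1) v(1) by (simp add: Q_def)
        moreover have "u \<otimes> v \<notin> n"
          using prime_mult_notin[OF n' u(1) v(1)] by blast
        ultimately show ?thesis by blast
      qed auto
    qed
    then obtain q h where qh: "q \<in> Q" "h \<in> J" "\<one> = q \<oplus> h" by blast
    have q: "q = \<one> \<ominus> h"
      using qh J.a_Hcarr[of h] ideal.Icarr[OF Q, of q] by (simp add: minus_eq a_assoc r_neg)
    have dich: "f \<in> p \<and> g \<in> p \<or> \<one> \<ominus> h \<in> p" if "p \<in> Y" for p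
      using qh(1) fg that primeideal.I_prime[OF prime[OF that]] unfolding q by (auto simp: Q_def)
    \<comment> \<open>What lies outside \<open>m\<close> lies outside \<open>p\<close>: hence
      \<open>g \<notin> p\<close>, which forces \<open>\<one> \<ominus> h\<close> into
      \<open>p\<close>, while \<open>\<one> \<ominus> f\<close> stays out.\<close>
    obtain p where p: "p \<in> Y" "p \<subseteq> m" using Y(2) m(1) by blast
    then have "\<one> \<ominus> f \<notin> p" "\<one> \<ominus> h \<in> p" using m(3) g(2) dich by auto
    then show ?thesis using qh(2) dich p(1) by blast
  qed
  have "\<exists>F. \<forall>i::nat. F i \<in> J \<and> ((\<forall>p\<in>Y. F i \<in> p \<or> \<one> \<ominus> F (Suc i) \<in> p)
      \<and> (\<exists>p\<in>Y. \<one> \<ominus> F i \<notin> p \<and> \<one> \<ominus> F (Suc i) \<in> p))"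
  proof (rule dependent_nat_choice)
    show "\<exists>f. f \<in> J" using J.zero_closed by blast
    show "\<exists>h. h \<in> J \<and> (\<forall>p\<in>Y. f \<in> p \<or> \<one> \<ominus> h \<in> p) \<and> (\<exists>p\<in>Y. \<one> \<ominus> f \<notin> p \<and> \<one> \<ominus> h \<in> p)"
      if "f \<in> J" for f and i :: nat
      using step[OF that] by blast
  qed
  then obtain F where F: "\<And>i::nat. F i \<in> J" "\<And>i p. p \<in> Y \<Longrightarrow> F i \<in> p \<or> \<one> \<ominus> F (Suc i) \<in> p"
    "\<And>i. \<exists>p\<in>Y. \<one> \<ominus> F i \<notin> p \<and> \<one> \<ominus> F (Suc i) \<in> p"
    by blast
  have carr: "F i \<in> carrier R" for i using F(1) J.a_Hcarr by blast
  have Y_Spec: "p \<in> Spec R" if "p \<in> Y" for p using that Y(1) by blast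
  from chain show False
  proof
    let ?A = "\<lambda>i. Y \<inter> V R (\<one> \<ominus> F i)"
    assume "acc {Y \<inter> V R f | f. f \<in> carrier R}"
    moreover have "range ?A \<subseteq> {Y \<inter> V R f | f. f \<in> carrier R}" using carr by blast
    moreover have "incseq ?A"
      using F(2) one_minus by (intro incseq_SucI) (auto simp: V_def)
    ultimately obtain n where n: "\<forall>k\<ge>n. ?A k = ?A n"
      unfolding acc_def by blast
    have "?A (Suc n) = ?A n" using n[rule_format, of "Suc n"] by simp
    moreover obtain p where "p \<in> Y" "\<one> \<ominus> F n \<notin> p" "\<one> \<ominus> F (Suc n) \<in> p" using F(3) by blast
    ultimately show False using Y_Spec by (auto simp: V_def)
  next
    let ?A = "\<lambda>i. Y \<inter> V R (F i)"
    assume "dcc {Y \<inter> V R f | f. f \<in> carrier R}"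
    moreover have "range ?A \<subseteq> {Y \<inter> V R f | f. f \<in> carrier R}" using carr by blast
    moreover have "decseq ?A"
      using F(2) one_minus by (intro decseq_SucI) (auto simp: V_def)
    ultimately obtain n where n: "\<forall>k\<ge>n. ?A k = ?A n"
      unfolding dcc_def by blast
    \<comment> \<open>A prime containing \<open>\<one> \<ominus> F (n + 2)\<close> but not
      \<open>\<one> \<ominus> F (n + 1)\<close> contains \<open>F n\<close> and misses
      \<open>F (n + 2)\<close>. Strict descent is therefore obtained over two indices rather than
      one.\<close>
    have "?A (Suc (Suc n)) = ?A n" using n[rule_format, of "Suc (Suc n)"] by simp
    moreover obtain p where p: "p \<in> Y" "\<one> \<ominus> F (Suc n) \<notin> p" "\<one> \<ominus> F (Suc (Suc n)) \<in> p"
      using F(3) by blast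
    moreover have "F n \<in> p" "F (Suc (Suc n)) \<notin> p" using p F(2) one_minus by blast+
    ultimately show False using Y_Spec by (auto simp: V_def)
  qed
qed

section \<open>Linear algebra at a prime, without determinants\<close>

text \<open>Gaussian elimination with cleared denominators, column by column: over the fraction
  field of R/p a matrix with more rows than columns has a nonzero left kernel, and
  \<open>y l \<notin> p\<close> expresses that the vector is nonzero there.\<close>

lemma (in cring) prime_left_kernel:
  assumes p: "primeideal p R" and fin: "finite B" "finite A" and card: "card B < card A"
    and "\<And>i j. i \<in> A \<Longrightarrow> j \<in> B \<Longrightarrow> c i j \<in> carrier R"
  shows "\<exists>y\<in>A \<rightarrow> carrier R. (\<exists>l\<in>A. y l \<notin> p) \<and> (\<forall>j\<in>B. (\<Oplus>i\<in>A. y i \<otimes> c i j) \<in> p)"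
  using fin card assms(5)
proof (induction B arbitrary: A c rule: finite_induct)
  case empty
  then obtain l where "l \<in> A" by fastforce
  then show ?case using prime_one_notin[OF p] by (intro bexI[of _ "\<lambda>_. \<one>"]) auto
next
  case (insert j B)
  have ideal: "ideal p R" using p by (rule primeideal.axioms(1))
  show ?case
  proof (cases "\<forall>i\<in>A. c i j \<in> p")
    case True
    obtain y where y: "y \<in> A \<rightarrow> carrier R" "\<exists>l\<in>A. y l \<notin> p" "\<forall>j\<in>B. (\<Oplus>i\<in>A. y i \<otimes> c i j) \<in> p"
      using insert.IH[of A c] insert.prems insert.hyps by auto
    moreover have "(\<Oplus>i\<in>A. y i \<otimes> c i j) \<in> p"
      using y(1) True insert.prems ideal
      by (intro ideal_finsum_closed ideal.I_l_closed) auto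
    ultimately show ?thesis by auto
  next
    case False
    then obtain l where l: "l \<in> A" "c l j \<notin> p" by blast
    define A' where "A' = A - {l}"
    have A': "A = insert l A'" "l \<notin> A'" "finite A'" "card B < card A'"
      using l insert.prems insert.hyps by (auto simp: A'_def)
    have cc [simp]: "c i k \<in> carrier R" if "i \<in> A" "k \<in> insert j B" for i k
      using that insert.prems by blast
    have sub: "i \<in> A" if "i \<in> A'" for i using that A' by blast
    \<comment> \<open>Elimination with pivot \<open>c l j\<close>: each remaining row is scaled by
      the pivot, then the multiple of row \<open>l\<close> that clears column \<open>j\<close> is
      subtracted.\<close>
    define c' where "c' i k = c l j \<otimes> c i k \<ominus> c i j \<otimes> c l k" for i k
    obtain y where y: "y \<in> A' \<rightarrow> carrier R" "\<exists>l\<in>A'. y l \<notin> p" "\<forall>j\<in>B. (\<Oplus>i\<in>A'. y i \<otimes> c' i j) \<in> p"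
      using insert.IH[of A' c'] A' sub l by (auto simp: c'_def)
    have yc [simp]: "y i \<in> carrier R" if "i \<in> A'" for i using y(1) that by blast
    define s where "s = (\<Oplus>i\<in>A'. y i \<otimes> c i j)"
    have s: "s \<in> carrier R" using sub unfolding s_def by (intro finsum_closed) auto
    \<comment> \<open>The elimination is undone on the solution: \<open>y\<close> is scaled by the
      pivot, and row \<open>l\<close> gets the coefficient that accounts for what was subtracted.
      The result is nonzero modulo \<open>p\<close> because neither the pivot nor some entry of
      \<open>y\<close> lies in \<open>p\<close>.\<close>
    define z where "z i = (if i = l then \<ominus> s else c l j \<otimes> y i)" for i
    have z: "z \<in> A \<rightarrow> carrier R" using s A' l by (auto simp: z_def)
    have zc [simp]: "z i \<in> carrier R" if "i \<in> A" for i using z that by blast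
    have sum_z: "(\<Oplus>i\<in>A. z i \<otimes> c i k) = (\<Oplus>i\<in>A'. y i \<otimes> c' i k)" if k: "k \<in> insert j B" for k
    proof -
      have "(\<Oplus>i\<in>A'. y i \<otimes> c' i k) = (\<Oplus>i\<in>A'. z i \<otimes> c i k \<oplus> (\<ominus> c l k) \<otimes> (y i \<otimes> c i j))"
      proof (intro finsum_cong' refl)
        fix i assume i: "i \<in> A'"
        then have "c i k \<in> carrier R" "c i j \<in> carrier R" "c l k \<in> carrier R" "c l j \<in> carrier R"
          "y i \<in> carrier R" using k sub l by auto
        then have "y i \<otimes> c' i k = c l j \<otimes> y i \<otimes> c i k \<oplus> (\<ominus> c l k) \<otimes> (y i \<otimes> c i j)"
          unfolding c'_def by algebra
        then show "y i \<otimes> c' i k = z i \<otimes> c i k \<oplus> (\<ominus> c l k) \<otimes> (y i \<otimes> c i j)"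
          using i A' by (auto simp: z_def)
      qed (use k sub l z in auto)
      also have "\<dots> = (\<Oplus>i\<in>A'. z i \<otimes> c i k) \<oplus> (\<Oplus>i\<in>A'. (\<ominus> c l k) \<otimes> (y i \<otimes> c i j))"
        using k sub l z A' by (intro finsum_addf) auto
      also have "(\<Oplus>i\<in>A'. (\<ominus> c l k) \<otimes> (y i \<otimes> c i j)) = (\<ominus> c l k) \<otimes> s"
        unfolding s_def using k sub l A' by (intro finsum_rdistr[symmetric]) auto
      also have "\<dots> = z l \<otimes> c l k"
        using s cc[OF l(1) k] m_comm[of s "c l k"] by (simp add: z_def l_minus)
      also have "(\<Oplus>i\<in>A'. z i \<otimes> c i k) \<oplus> z l \<otimes> c l k = (\<Oplus>i\<in>A. z i \<otimes> c i k)"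
        using k sub l z A' by (subst A'(1), subst finsum_insert) (auto simp: a_comm)
      finally show ?thesis by simp
    qed
    have "(\<Oplus>i\<in>A. z i \<otimes> c i j) \<in> p"
    proof -
      have "(\<Oplus>i\<in>A'. y i \<otimes> c' i j) = (\<Oplus>i\<in>A'. \<zero>)"
        using sub l by (intro finsum_cong') (auto simp: c'_def m_comm minus_eq r_neg)
      then show ?thesis
        using sum_z[of j] additive_subgroup.zero_closed[OF ideal.axioms(1)[OF ideal]] by (simp add: finsum_zero)
    qed
    moreover have "(\<Oplus>i\<in>A. z i \<otimes> c i k) \<in> p" if "k \<in> B" for k
      using sum_z[of k] y(3) that by simp
    moreover obtain l' where l': "l' \<in> A'" "y l' \<notin> p" using y(2) by blast
    have "z l' \<notin> p"
      using primeideal.I_prime[OF p, of "c l j" "y l'"] l l' A' by (auto simp: z_def)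
    ultimately show ?thesis using z l' sub by blast
  qed
qed

text \<open>The row \<open>k\<close> is annihilated by the matrix t I - c, which modulo
  \<open>m\<close> is \<open>t\<close> times the identity and so is invertible at \<open>m\<close>.
  Unknowns are eliminated one at a time instead of multiplying by an adjugate.\<close>

lemma (in cring) nakayama:
  assumes m: "primeideal m R" and "finite S" "t \<in> carrier R - m"
    and "\<And>i j. i \<in> S \<Longrightarrow> j \<in> S \<Longrightarrow> c i j \<in> m" "\<And>i. i \<in> S \<Longrightarrow> k i \<in> carrier R"
    and "\<And>j. j \<in> S \<Longrightarrow> t \<otimes> k j = (\<Oplus>i\<in>S. k i \<otimes> c i j)"
  shows "\<exists>u\<in>carrier R - m. \<forall>i\<in>S. u \<otimes> k i = \<zero>"
  using assms(2-)
proof (induction S arbitrary: t c rule: finite_induct)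
  case empty
  then show ?case by blast
next
  case (insert x S)
  interpret m: primeideal m R by fact
  have k [simp]: "k i \<in> carrier R" if "i \<in> insert x S" for i using that insert.prems by blast
  have c [simp]: "c i j \<in> carrier R" if "i \<in> insert x S" "j \<in> insert x S" for i j
    using that insert.prems(2) m.Icarr by blast
  have t: "t \<in> carrier R" using insert.prems by blast
  \<comment> \<open>The diagonal entry of t I - c at \<open>x\<close>, still outside
    \<open>m\<close>; up to this factor the equation at \<open>x\<close> can be solved for
    \<open>k x\<close>.\<close>
  define v where "v = t \<ominus> c x x"
  have v: "v \<in> carrier R - m"
    using insert.prems(1) insert.prems(2)[of x x] ideal_minus_mem_iff[OF m.is_ideal t, of "c x x"] t
    by (auto simp: v_def)
  have split: "t \<otimes> k j = k x \<otimes> c x j \<oplus> (\<Oplus>i\<in>S. k i \<otimes> c i j)" if "j \<in> insert x S" for j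
    using insert.prems(4)[OF that] insert.hyps that by (subst (asm) finsum_insert) auto
  have sumc [simp]: "(\<Oplus>i\<in>S. k i \<otimes> c i j) \<in> carrier R" if "j \<in> insert x S" for j
    using that by (intro finsum_closed) auto
  have vx: "v \<otimes> k x = (\<Oplus>i\<in>S. k i \<otimes> c i x)"
  proof -
    have "v \<otimes> k x = t \<otimes> k x \<ominus> k x \<otimes> c x x"
      using t c[OF insertI1 insertI1] k[OF insertI1] unfolding v_def by algebra
    also have "\<dots> = (\<Oplus>i\<in>S. k i \<otimes> c i x)"
      using c[of x x] k[of x] sumc[of x] split[of x] by (simp add: minus_eq a_ac r_neg2 r_neg)
    finally show ?thesis .
  qed
  \<comment> \<open>Substituting for \<open>v \<otimes> k x\<close> in \<open>v\<close> times the
    other equations gives a system of the same shape, with \<open>v \<otimes> t\<close> in place of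
    \<open>t\<close> and entries that remain in \<open>m\<close>.\<close>
  define c' where "c' i j = v \<otimes> c i j \<oplus> c i x \<otimes> c x j" for i j
  have "\<exists>u\<in>carrier R - m. \<forall>i\<in>S. u \<otimes> k i = \<zero>"
  proof (rule insert.IH[of "v \<otimes> t" c'])
    show "v \<otimes> t \<in> carrier R - m"
      using prime_mult_notin[OF m] v insert.prems(1) by blast
    show "c' i j \<in> m" if "i \<in> S" "j \<in> S" for i j
      using that v insert.prems(2) unfolding c'_def
      by (intro m.a_closed m.I_l_closed) auto
    show "k i \<in> carrier R" if "i \<in> S" for i using that by simp
    show "v \<otimes> t \<otimes> k j = (\<Oplus>i\<in>S. k i \<otimes> c' i j)" if j: "j \<in> S" for j
    proof -
      have "v \<otimes> t \<otimes> k j = v \<otimes> (k x \<otimes> c x j \<oplus> (\<Oplus>i\<in>S. k i \<otimes> c i j))"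
        using split[of j] j v t by (simp add: m_assoc)
      also have "\<dots> = c x j \<otimes> (v \<otimes> k x) \<oplus> v \<otimes> (\<Oplus>i\<in>S. k i \<otimes> c i j)"
        using j v by (simp add: r_distr m_ac)
      also have "\<dots> = (\<Oplus>i\<in>S. c x j \<otimes> (k i \<otimes> c i x)) \<oplus> (\<Oplus>i\<in>S. v \<otimes> (k i \<otimes> c i j))"
        unfolding vx using j v insert.hyps(1) by (simp add: finsum_rdistr Pi_iff)
      also have "\<dots> = (\<Oplus>i\<in>S. c x j \<otimes> (k i \<otimes> c i x) \<oplus> v \<otimes> (k i \<otimes> c i j))"
        using j v by (intro finsum_addf[symmetric]) auto
      also have "\<dots> = (\<Oplus>i\<in>S. k i \<otimes> c' i j)"
        using j v by (intro finsum_cong') (auto simp: c'_def r_distr m_ac a_ac)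
      finally show ?thesis .
    qed
  qed
  then obtain u where u: "u \<in> carrier R - m" "\<And>i. i \<in> S \<Longrightarrow> u \<otimes> k i = \<zero>" by blast
  have "u \<otimes> v \<otimes> k i = \<zero>" if "i \<in> insert x S" for i
  proof (cases "i = x")
    case True
    have "u \<otimes> v \<otimes> k x = (\<Oplus>i\<in>S. u \<otimes> (k i \<otimes> c i x))"
      using u v vx insert.hyps(1) by (simp add: m_assoc finsum_rdistr Pi_iff)
    also have "\<dots> = (\<Oplus>i\<in>S. \<zero>)"
    proof (intro finsum_cong' refl)
      fix i assume "i \<in> S"
      then show "u \<otimes> (k i \<otimes> c i x) = \<zero>"
        using u by (simp flip: m_assoc)
    qed auto
    finally show ?thesis using True by (simp add: finsum_zero)
  next
    case False
    then have "u \<otimes> v \<otimes> k i = v \<otimes> (u \<otimes> k i)" using that u(1) v by (simp add: m_ac)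
    also have "\<dots> = \<zero>" using False that u v by simp
    finally show ?thesis .
  qed
  then show ?case using prime_mult_notin[OF m u(1) v] by blast
qed

section \<open>Row vectors times square matrices\<close>

definition row_mult :: "('a, 'r) ring_scheme \<Rightarrow> 'i set \<Rightarrow> ('i \<Rightarrow> 'a) \<Rightarrow> ('i \<Rightarrow> 'i \<Rightarrow> 'a) \<Rightarrow> 'i \<Rightarrow> 'a" where
  "row_mult R S k a t = (\<Oplus>\<^bsub>R\<^esub>s\<in>S. k s \<otimes>\<^bsub>R\<^esub> a s t)"

context cring
begin

lemma row_mult_closed [simp]:
  assumes "\<And>s. s \<in> S \<Longrightarrow> k s \<in> carrier R" "\<And>s. s \<in> S \<Longrightarrow> a s t \<in> carrier R"
  shows "row_mult R S k a t \<in> carrier R"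
  using assms unfolding row_mult_def by (intro finsum_closed) auto

lemma row_mult_cong:
  assumes "\<And>s. s \<in> S \<Longrightarrow> k s = l s" "\<And>s. s \<in> S \<Longrightarrow> l s \<in> carrier R" "\<And>s. s \<in> S \<Longrightarrow> a s t \<in> carrier R"
  shows "row_mult R S k a t = row_mult R S l a t"
  using assms unfolding row_mult_def by (intro finsum_cong') auto

lemma row_mult_add:
  assumes "\<And>s. s \<in> S \<Longrightarrow> k s \<in> carrier R" "\<And>s. s \<in> S \<Longrightarrow> l s \<in> carrier R" "\<And>s. s \<in> S \<Longrightarrow> a s t \<in> carrier R"
  shows "row_mult R S (\<lambda>s. k s \<oplus> l s) a t = row_mult R S k a t \<oplus> row_mult R S l a t"
proof -
  have "row_mult R S (\<lambda>s. k s \<oplus> l s) a t = (\<Oplus>s\<in>S. k s \<otimes> a s t \<oplus> l s \<otimes> a s t)"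
    using assms unfolding row_mult_def by (intro finsum_cong') (auto simp: l_distr)
  then show ?thesis
    using assms unfolding row_mult_def by (simp add: finsum_addf Pi_iff)
qed

lemma row_mult_smult:
  assumes "finite S" "x \<in> carrier R" "\<And>s. s \<in> S \<Longrightarrow> k s \<in> carrier R" "\<And>s. s \<in> S \<Longrightarrow> a s t \<in> carrier R"
  shows "row_mult R S (\<lambda>s. x \<otimes> k s) a t = x \<otimes> row_mult R S k a t"
proof -
  have "row_mult R S (\<lambda>s. x \<otimes> k s) a t = (\<Oplus>s\<in>S. x \<otimes> (k s \<otimes> a s t))"
    using assms unfolding row_mult_def by (intro finsum_cong') (auto simp: m_assoc)
  then show ?thesis
    using assms unfolding row_mult_def by (simp add: finsum_rdistr Pi_iff)
qed

lemma row_mult_minus: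
  assumes "finite S" "\<And>s. s \<in> S \<Longrightarrow> k s \<in> carrier R" "\<And>s. s \<in> S \<Longrightarrow> l s \<in> carrier R"
    "\<And>s. s \<in> S \<Longrightarrow> a s t \<in> carrier R"
  shows "row_mult R S (\<lambda>s. k s \<ominus> l s) a t = row_mult R S k a t \<ominus> row_mult R S l a t"
proof -
  have "row_mult R S (\<lambda>s. k s \<ominus> l s) a t = row_mult R S (\<lambda>s. k s \<oplus> (\<ominus> \<one>) \<otimes> l s) a t"
    using assms by (intro row_mult_cong) (auto simp: minus_eq l_minus)
  also have "\<dots> = row_mult R S k a t \<oplus> (\<ominus> \<one>) \<otimes> row_mult R S l a t"
    using assms by (simp add: row_mult_add row_mult_smult)
  finally show ?thesis using assms by (simp add: l_minus minus_eq)
qed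

lemma row_mult_row_mult:
  assumes "finite S" "\<And>s. s \<in> S \<Longrightarrow> k s \<in> carrier R" "\<And>r s. r \<in> S \<Longrightarrow> s \<in> S \<Longrightarrow> a r s \<in> carrier R"
    "\<And>s. s \<in> S \<Longrightarrow> b s t \<in> carrier R"
  shows "row_mult R S (row_mult R S k a) b t = (\<Oplus>s\<in>S. k s \<otimes> row_mult R S (a s) b t)"
proof -
  have "row_mult R S (row_mult R S k a) b t = (\<Oplus>r\<in>S. \<Oplus>s\<in>S. k s \<otimes> a s r \<otimes> b r t)"
    using assms unfolding row_mult_def by (intro finsum_cong' refl) (auto simp: finsum_ldistr Pi_iff intro!: finsum_closed)
  also have "\<dots> = (\<Oplus>s\<in>S. \<Oplus>r\<in>S. k s \<otimes> a s r \<otimes> b r t)"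
    using assms by (intro finsum_swap) auto
  also have "\<dots> = (\<Oplus>s\<in>S. \<Oplus>r\<in>S. k s \<otimes> (a s r \<otimes> b r t))"
    using assms by (intro finsum_cong' refl) (auto simp: m_assoc intro!: finsum_cong' finsum_closed)
  also have "\<dots> = (\<Oplus>s\<in>S. k s \<otimes> row_mult R S (a s) b t)"
    using assms unfolding row_mult_def by (intro finsum_cong' refl) (auto simp: finsum_rdistr Pi_iff)
  finally show ?thesis .
qed

lemma row_mult_finsum:
  assumes "finite S" "finite T" "\<And>i. i \<in> T \<Longrightarrow> c i \<in> carrier R"
    "\<And>i s. i \<in> T \<Longrightarrow> s \<in> S \<Longrightarrow> f i s \<in> carrier R" "\<And>s. s \<in> S \<Longrightarrow> a s t \<in> carrier R"
  shows "row_mult R S (\<lambda>s. \<Oplus>i\<in>T. c i \<otimes> f i s) a t = (\<Oplus>i\<in>T. c i \<otimes> row_mult R S (f i) a t)"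
proof -
  have "row_mult R S (\<lambda>s. \<Oplus>i\<in>T. c i \<otimes> f i s) a t = (\<Oplus>s\<in>S. \<Oplus>i\<in>T. c i \<otimes> f i s \<otimes> a s t)"
    unfolding row_mult_def using assms
    by (intro finsum_cong' refl) (auto simp: finsum_ldistr Pi_iff intro!: finsum_closed)
  also have "\<dots> = (\<Oplus>i\<in>T. \<Oplus>s\<in>S. c i \<otimes> f i s \<otimes> a s t)"
    using assms by (intro finsum_swap) auto
  also have "\<dots> = (\<Oplus>i\<in>T. \<Oplus>s\<in>S. c i \<otimes> (f i s \<otimes> a s t))"
    using assms by (intro finsum_cong' refl) (auto simp: m_assoc intro!: finsum_cong' finsum_closed)
  also have "\<dots> = (\<Oplus>i\<in>T. c i \<otimes> row_mult R S (f i) a t)"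
    unfolding row_mult_def using assms by (intro finsum_cong' refl) (auto simp: finsum_rdistr Pi_iff)
  finally show ?thesis .
qed

end

section \<open>Modules of relations with purity\<close>

text \<open>\<open>K\<close> is a submodule of R^S, and \<open>pure\<close> is the equational
  criterion for the quotient to be flat, so tensor products do not enter here. Vectors are functions
  on the whole type \<open>'i\<close>, of which only the values on \<open>S\<close> count;
  \<open>K_cong\<close> makes \<open>K\<close> insensitive to the others.\<close>

locale pure_relations = cring R for R (structure) +
  fixes S :: "'i set" and K :: "('i \<Rightarrow> 'a) set"
  assumes finite_index: "finite S"
    and K_carrier: "k \<in> K \<Longrightarrow> s \<in> S \<Longrightarrow> k s \<in> carrier R"
    and K_cong: "k \<in> K \<Longrightarrow> (\<And>s. s \<in> S \<Longrightarrow> k s = l s) \<Longrightarrow> l \<in> K"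
    and K_zero: "(\<lambda>_. \<zero>) \<in> K"
    and K_add: "k \<in> K \<Longrightarrow> l \<in> K \<Longrightarrow> (\<lambda>s. k s \<oplus> l s) \<in> K"
    and K_smult: "x \<in> carrier R \<Longrightarrow> k \<in> K \<Longrightarrow> (\<lambda>s. x \<otimes> k s) \<in> K"
    and pure: "k \<in> K \<Longrightarrow> \<exists>a\<in>S \<rightarrow> K. \<forall>t\<in>S. k t = row_mult R S k a t"
begin

lemma K_minus:
  assumes "k \<in> K" "l \<in> K"
  shows "(\<lambda>s. k s \<ominus> l s) \<in> K"
  by (rule K_cong[OF K_add[OF assms(1) K_smult[OF _ assms(2), of "\<ominus> \<one>"]]])
    (use assms in \<open>auto simp: minus_eq l_minus K_carrier\<close>)

lemma K_finsum:
  assumes "finite T" "\<And>i. i \<in> T \<Longrightarrow> f i \<in> K" "\<And>i. i \<in> T \<Longrightarrow> x i \<in> carrier R"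
  shows "(\<lambda>s. \<Oplus>i\<in>T. x i \<otimes> f i s) \<in> K"
  using assms
proof (induction T rule: finite_induct)
  case empty
  then show ?case using K_zero by simp
next
  case (insert j T)
  then have "(\<lambda>s. x j \<otimes> f j s \<oplus> (\<Oplus>i\<in>T. x i \<otimes> f i s)) \<in> K"
    by (intro K_add K_smult) auto
  then show ?case
    by (rule K_cong) (use insert in \<open>auto simp: finsum_insert K_carrier Pi_iff\<close>)
qed

lemma row_mult_in_K:
  assumes "k \<in> K" "a \<in> S \<rightarrow> K"
  shows "row_mult R S k a \<in> K"
  using K_finsum[OF finite_index, of a k] assms K_carrier unfolding row_mult_def by blast

text \<open>If \<open>a\<close> fixes \<open>F\<close> and \<open>b\<close> fixes \<open>k - ka\<close>, then \<open>a + b - ab\<close> fixes \<open>F\<close> and \<open>k\<close>.\<close>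

lemma pure_finite:
  assumes "finite F" "F \<subseteq> K"
  shows "\<exists>a\<in>S \<rightarrow> K. \<forall>k\<in>F. \<forall>t\<in>S. k t = row_mult R S k a t"
  using assms
proof (induction F rule: finite_induct)
  case empty
  then show ?case using K_zero by (intro bexI[of _ "\<lambda>_ _. \<zero>"]) auto
next
  case (insert k F)
  then obtain a where a: "a \<in> S \<rightarrow> K" "\<And>l t. l \<in> F \<Longrightarrow> t \<in> S \<Longrightarrow> l t = row_mult R S l a t" by auto
  have k: "k \<in> K" using insert by auto
  define k' where "k' s = k s \<ominus> row_mult R S k a s" for s
  have k': "k' \<in> K" unfolding k'_def using k a by (intro K_minus row_mult_in_K)
  obtain b where b: "b \<in> S \<rightarrow> K" "\<And>t. t \<in> S \<Longrightarrow> k' t = row_mult R S k' b t" using pure[OF k'] by blast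
  \<comment> \<open>As matrices, 1 - c = (1 - a)(1 - b): a row fixed by \<open>a\<close> dies at the
    first factor, while \<open>k\<close> becomes \<open>k'\<close> there and dies at the
    second.\<close>
  define c where "c s t = a s t \<oplus> b s t \<ominus> row_mult R S (a s) b t" for s t
  have c: "c \<in> S \<rightarrow> K"
    unfolding c_def using a(1) b(1) by (intro Pi_I K_minus K_add row_mult_in_K) auto
  have carr: "a s t \<in> carrier R" "b s t \<in> carrier R" if "s \<in> S" "t \<in> S" for s t
    using a(1) b(1) that K_carrier by blast+
  have mult_c: "row_mult R S l c t
      = row_mult R S l a t \<oplus> (row_mult R S l b t \<ominus> row_mult R S (row_mult R S l a) b t)"
    if l: "l \<in> K" and t: "t \<in> S" for l t
  proof -
    have l': "l s \<in> carrier R" if "s \<in> S" for s using l that by (rule K_carrier)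
    have ab: "row_mult R S (a s) b t \<in> carrier R" if "s \<in> S" for s
      using that t carr by simp
    have "row_mult R S l c t = (\<Oplus>s\<in>S. l s \<otimes> a s t \<oplus> (l s \<otimes> b s t \<oplus> (\<ominus> \<one>) \<otimes> (l s \<otimes> row_mult R S (a s) b t)))"
      unfolding row_mult_def[of R S l c]
    proof (intro finsum_cong' refl Pi_I)
      fix s assume s: "s \<in> S"
      note facts = carr[OF s t] ab[OF s] l'[OF s]
      show "l s \<otimes> c s t = l s \<otimes> a s t \<oplus> (l s \<otimes> b s t \<oplus> (\<ominus> \<one>) \<otimes> (l s \<otimes> row_mult R S (a s) b t))"
        unfolding c_def using facts by algebra
      show "l s \<otimes> a s t \<oplus> (l s \<otimes> b s t \<oplus> (\<ominus> \<one>) \<otimes> (l s \<otimes> row_mult R S (a s) b t)) \<in> carrier R"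
        using facts by auto
    qed
    also have "\<dots> = row_mult R S l a t \<oplus> (row_mult R S l b t \<oplus> (\<ominus> \<one>) \<otimes> (\<Oplus>s\<in>S. l s \<otimes> row_mult R S (a s) b t))"
      using carr t l' ab finite_index unfolding row_mult_def[of R S l a] row_mult_def[of R S l b]
      by (simp add: finsum_addf finsum_rdistr Pi_iff)
    also have "(\<Oplus>s\<in>S. l s \<otimes> row_mult R S (a s) b t) = row_mult R S (row_mult R S l a) b t"
      using carr t l' finite_index by (intro row_mult_row_mult[symmetric]) auto
    finally show ?thesis
      using carr t l' by (simp add: minus_eq l_minus)
  qed
  have "l t = row_mult R S l c t" if l: "l \<in> insert k F" and t: "t \<in> S" for l t
  proof -
    have lK: "l \<in> K" using l insert.prems by blast
    then have l': "l s \<in> carrier R" if "s \<in> S" for s using that by (rule K_carrier)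
    have la: "row_mult R S l a s \<in> carrier R" if "s \<in> S" for s
      using that l' carr by simp
    have eq: "row_mult R S l b t \<ominus> row_mult R S (row_mult R S l a) b t = l t \<ominus> row_mult R S l a t"
    proof (cases "l \<in> F")
      case True
      have "row_mult R S (row_mult R S l a) b t = row_mult R S l b t"
        using a(2)[OF True] l' carr t la by (intro row_mult_cong) auto
      then show ?thesis using a(2)[OF True] l' carr t by (simp add: r_neg minus_eq)
    next
      case False
      then have "l = k" using l by blast
      then show ?thesis
        using b(2)[OF t] row_mult_minus[OF finite_index, of l "row_mult R S l a" b t] l' la carr t
        unfolding k'_def by simp
    qed
    have "row_mult R S l c t = row_mult R S l a t \<oplus> (l t \<ominus> row_mult R S l a t)"
      using mult_c[OF lK t] eq by simp
    also have "\<dots> = l t" using la[OF t] l'[OF t] by algebra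
    finally show ?thesis by simp
  qed
  then show ?case using c by blast
qed

section \<open>Frames and the local rank of the relations\<close>

definition frame :: "'i set \<Rightarrow> 'a \<Rightarrow> ('i \<Rightarrow> 'i \<Rightarrow> 'a) \<Rightarrow> bool" where
  "frame T t f \<longleftrightarrow> T \<subseteq> S \<and> t \<in> carrier R \<and> f \<in> T \<rightarrow> K \<and>
    (\<forall>i\<in>T. \<forall>j\<in>T. f i j = (if i = j then t else \<zero>))"

lemma frame_carrier:
  assumes "frame T t f"
  shows "T \<subseteq> S" "finite T" "t \<in> carrier R" "\<And>i. i \<in> T \<Longrightarrow> f i \<in> K"
    "\<And>i j. i \<in> T \<Longrightarrow> j \<in> S \<Longrightarrow> f i j \<in> carrier R"
  using assms finite_subset[OF _ finite_index] by (auto simp: frame_def intro: K_carrier)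

lemma frame_extend:
  assumes fr: "frame T t f" and k: "k \<in> K" "\<And>i. i \<in> T \<Longrightarrow> k i = \<zero>" and j: "j \<in> S - T"
  shows "\<exists>g. frame (insert j T) (t \<otimes> k j) g"
proof -
  note fr' = frame_carrier[OF fr]
  have kc: "k s \<in> carrier R" if "s \<in> S" for s using k(1) that by (rule K_carrier)
  \<comment> \<open>The new row is \<open>t\<close> times \<open>k\<close>; each old row is scaled
    by \<open>k j\<close> and its entry in column \<open>j\<close> is cleared with \<open>k\<close>.
    As \<open>k\<close> vanishes on \<open>T\<close>, the old columns are merely scaled, so all
    diagonal entries become \<open>t \<otimes> k j\<close>.\<close>
  define g where "g i = (if i = j then (\<lambda>s. t \<otimes> k s) else (\<lambda>s. k j \<otimes> f i s \<ominus> f i j \<otimes> k s))" for i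
  have "frame (insert j T) (t \<otimes> k j) g"
    unfolding frame_def
  proof (intro conjI ballI)
    show "g \<in> insert j T \<rightarrow> K"
      using k(1) j kc fr' by (auto simp: g_def intro!: K_smult K_minus)
    show "g i i' = (if i = i' then t \<otimes> k j else \<zero>)" if "i \<in> insert j T" "i' \<in> insert j T" for i i'
    proof (cases "i = j")
      case True
      then show ?thesis using that k(2) fr' by (auto simp: g_def)
    next
      case False
      then have i: "i \<in> T" using that by blast
      have fij: "f i j \<in> carrier R" "f i i' \<in> carrier R" "k j \<in> carrier R" using fr' i j that kc by auto
      show ?thesis
      proof (cases "i' = j")
        case True
        then show ?thesis using fij False by (simp add: g_def m_comm r_neg minus_eq)
      next
        case i': False
        then have "i' \<in> T" using that by blast
        moreover have "f i i' = (if i = i' then t else \<zero>)"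
          using fr i \<open>i' \<in> T\<close> by (auto simp: frame_def)
        ultimately show ?thesis using fij k(2) fr' False by (auto simp: g_def m_comm minus_eq)
      qed
    qed
  qed (use j fr' kc in auto)
  then show ?thesis by blast
qed

lemma frame_subset: "frame T t f \<Longrightarrow> T' \<subseteq> T \<Longrightarrow> frame T' t f"
  unfolding frame_def by blast

lemma frame_empty: "frame {} \<one> f"
  by (simp add: frame_def)

text \<open>Subtracting the frame rows, weighted by the coordinates of \<open>k\<close>, from
  \<open>t\<close> times \<open>k\<close> clears the columns in \<open>T\<close>. This produces
  relations of the kind by which a frame can be extended.\<close>

lemma frame_reduce:
  assumes fr: "frame T t f" and k: "k \<in> K"
  shows "(\<lambda>s. t \<otimes> k s \<ominus> (\<Oplus>i\<in>T. k i \<otimes> f i s)) \<in> K"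
    and "j \<in> T \<Longrightarrow> t \<otimes> k j \<ominus> (\<Oplus>i\<in>T. k i \<otimes> f i j) = \<zero>"
proof -
  note fr' = frame_carrier[OF fr]
  have kc: "k s \<in> carrier R" if "s \<in> S" for s using k(1) that by (rule K_carrier)
  show "(\<lambda>s. t \<otimes> k s \<ominus> (\<Oplus>i\<in>T. k i \<otimes> f i s)) \<in> K"
    using fr' kc k by (intro K_minus K_smult K_finsum) auto
  assume j: "j \<in> T"
  have "(\<Oplus>i\<in>T. k i \<otimes> f i j) = (\<Oplus>i\<in>T. if j = i then k i \<otimes> t else \<zero>)"
    using fr fr' kc j by (intro finsum_cong') (auto simp: frame_def)
  also have "\<dots> = k j \<otimes> t"
    using fr' kc j by (intro add.finprod_singleton) auto
  finally show "t \<otimes> k j \<ominus> (\<Oplus>i\<in>T. k i \<otimes> f i j) = \<zero>"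
    using fr' kc j by (simp add: m_comm minus_eq r_neg subset_iff)
qed

definition frame_values :: "nat \<Rightarrow> 'a set" where
  "frame_values r = {t. \<exists>T f. frame T t f \<and> card T = r}"

lemma frame_valuesI: "frame T t f \<Longrightarrow> card T = r \<Longrightarrow> t \<in> frame_values r"
  unfolding frame_values_def by blast

lemma frame_values_carrier: "frame_values r \<subseteq> carrier R"
  using frame_carrier(3) by (auto simp: frame_values_def)

text \<open>A relation vanishing on \<open>T\<close> has all its entries in \<open>m\<close>, as an
  entry outside would extend the frame with a value outside \<open>m\<close>. Purity writes
  \<open>k\<close> as \<open>k\<close> times a matrix of relations; reducing the rows of this matrix
  by the frame moves its entries into \<open>m\<close>, and Nakayama's lemma applies.\<close>

lemma maximal_frame_kills:
  assumes m: "primeideal m R" and fr: "frame T t f" "t \<notin> m"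
    and max: "frame_values (Suc (card T)) \<subseteq> m"
    and k: "k \<in> K" "\<And>i. i \<in> T \<Longrightarrow> k i = \<zero>"
  shows "\<exists>u\<in>carrier R - m. \<forall>s\<in>S. u \<otimes> k s = \<zero>"
proof -
  interpret m: primeideal m R by fact
  note fr' = frame_carrier[OF fr(1)]
  have kc: "k s \<in> carrier R" if "s \<in> S" for s using k(1) that by (rule K_carrier)
  have in_m: "l j \<in> m" if l: "l \<in> K" "\<And>i. i \<in> T \<Longrightarrow> l i = \<zero>" and j: "j \<in> S" for l j
  proof (cases "j \<in> T")
    case False
    obtain g where "frame (insert j T) (t \<otimes> l j) g"
      using frame_extend[OF fr(1) l] False j by blast
    then have "t \<otimes> l j \<in> m"
      using max frame_valuesI card_insert_disjoint[OF fr'(2) False] by blast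
    then show ?thesis
      using m.I_prime[OF fr'(3) K_carrier[OF l(1) j]] fr(2) by blast
  qed (use l in simp)
  obtain a where a: "a \<in> S \<rightarrow> K" "\<And>j. j \<in> S \<Longrightarrow> k j = row_mult R S k a j" using pure[OF k(1)] by blast
  have aK: "a s \<in> K" if "s \<in> S" for s using a(1) that by blast
  have ac: "a s j \<in> carrier R" if "s \<in> S" "j \<in> S" for s j using K_carrier[OF aK] that by blast
  \<comment> \<open>The rows of \<open>a\<close> reduced by the frame. Then k c is t (k a) minus the
    combination of the \<open>f i\<close> with coefficients (k a)_i; these are \<open>k i\<close>,
    zero on \<open>T\<close>, so k c = t k.\<close>
  define c where "c s j = t \<otimes> a s j \<ominus> (\<Oplus>i\<in>T. a s i \<otimes> f i j)" for s j
  have TS: "i \<in> S" if "i \<in> T" for i using fr'(1) that by blast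
  show ?thesis
  proof (rule nakayama[OF m finite_index, of t c k])
    show "t \<in> carrier R - m" using fr'(3) fr(2) by blast
    show "c s j \<in> m" if "s \<in> S" "j \<in> S" for s j
      unfolding c_def
      by (rule in_m[OF frame_reduce(1)[OF fr(1) aK[OF that(1)]] _ that(2)])
        (rule frame_reduce(2)[OF fr(1) aK[OF that(1)]])
    show "k s \<in> carrier R" if "s \<in> S" for s using that by (rule kc)
    show "t \<otimes> k j = (\<Oplus>s\<in>S. k s \<otimes> c s j)" if j: "j \<in> S" for j
    proof -
      have "(\<Oplus>s\<in>S. k s \<otimes> c s j)
          = (\<Oplus>s\<in>S. t \<otimes> (k s \<otimes> a s j) \<oplus> (\<ominus> \<one>) \<otimes> (\<Oplus>i\<in>T. (k s \<otimes> a s i) \<otimes> f i j))"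
      proof (intro finsum_cong' refl Pi_I)
        fix s assume s: "s \<in> S"
        define w where "w = (\<Oplus>i\<in>T. a s i \<otimes> f i j)"
        have sum: "w \<in> carrier R"
          unfolding w_def using s j ac fr' TS by (intro finsum_closed) auto
        have "(\<Oplus>i\<in>T. (k s \<otimes> a s i) \<otimes> f i j) = (\<Oplus>i\<in>T. k s \<otimes> (a s i \<otimes> f i j))"
          using s j ac fr' TS kc by (intro finsum_cong') (auto simp: m_assoc)
        also have "\<dots> = k s \<otimes> w"
          unfolding w_def using s j ac fr' TS kc by (intro finsum_rdistr[symmetric]) auto
        finally have eq: "(\<Oplus>i\<in>T. (k s \<otimes> a s i) \<otimes> f i j) = k s \<otimes> w" .
        note facts = sum kc[OF s] ac[OF s j] fr'(3)
        show "k s \<otimes> c s j = t \<otimes> (k s \<otimes> a s j) \<oplus> (\<ominus> \<one>) \<otimes> (\<Oplus>i\<in>T. (k s \<otimes> a s i) \<otimes> f i j)"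
          unfolding c_def eq w_def[symmetric] using facts by algebra
        show "t \<otimes> (k s \<otimes> a s j) \<oplus> (\<ominus> \<one>) \<otimes> (\<Oplus>i\<in>T. (k s \<otimes> a s i) \<otimes> f i j) \<in> carrier R"
          unfolding eq using facts by auto
      qed
      also have "\<dots> = t \<otimes> (\<Oplus>s\<in>S. k s \<otimes> a s j) \<oplus> (\<ominus> \<one>) \<otimes> (\<Oplus>s\<in>S. \<Oplus>i\<in>T. (k s \<otimes> a s i) \<otimes> f i j)"
        using j ac fr' TS kc finite_index by (simp add: finsum_addf finsum_rdistr Pi_iff finsum_closed)
      also have "(\<Oplus>s\<in>S. k s \<otimes> a s j) = k j"
        using a(2)[OF j] by (simp add: row_mult_def)
      also have "(\<Oplus>s\<in>S. \<Oplus>i\<in>T. (k s \<otimes> a s i) \<otimes> f i j) = (\<Oplus>i\<in>T. \<Oplus>s\<in>S. (k s \<otimes> a s i) \<otimes> f i j)"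
        using j ac fr' TS kc finite_index by (intro finsum_swap) auto
      also have "\<dots> = (\<Oplus>i\<in>T. \<zero>)"
      proof (intro finsum_cong' refl)
        fix i assume i: "i \<in> T"
        have "(\<Oplus>s\<in>S. (k s \<otimes> a s i) \<otimes> f i j) = k i \<otimes> f i j"
          using i j ac fr' TS kc finite_index a(2)[OF TS[OF i]]
          by (simp add: finsum_ldistr Pi_iff row_mult_def)
        then show "(\<Oplus>s\<in>S. (k s \<otimes> a s i) \<otimes> f i j) = \<zero>" using i j k(2) fr' by simp
      qed auto
      finally show ?thesis using kc[OF j] fr'(3) by (simp add: finsum_zero)
    qed
  qed
qed

text \<open>The relation left after reducing \<open>k\<close> by the frame vanishes on
  \<open>T\<close>, so some \<open>u\<close> outside \<open>m\<close> kills it, and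
  \<open>u \<otimes> t\<close> is the required multiplier. At \<open>m\<close> the frame is thus a
  basis of \<open>K\<close>.\<close>

lemma maximal_frame_spans:
  assumes m: "primeideal m R" and fr: "frame T t f" "t \<notin> m"
    and max: "frame_values (Suc (card T)) \<subseteq> m" and k: "k \<in> K"
  shows "\<exists>u\<in>carrier R - m. \<exists>c\<in>T \<rightarrow> carrier R. \<forall>s\<in>S. u \<otimes> k s = (\<Oplus>i\<in>T. c i \<otimes> f i s)"
proof -
  note fr' = frame_carrier[OF fr(1)]
  have kc: "k s \<in> carrier R" if "s \<in> S" for s using k(1) that by (rule K_carrier)
  have TS: "i \<in> S" if "i \<in> T" for i using fr'(1) that by blast
  obtain u where u: "u \<in> carrier R - m"
    "\<And>s. s \<in> S \<Longrightarrow> u \<otimes> (t \<otimes> k s \<ominus> (\<Oplus>i\<in>T. k i \<otimes> f i s)) = \<zero>"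
    using maximal_frame_kills[OF m fr max frame_reduce[OF fr(1) k]] by blast
  have "u \<otimes> t \<otimes> k s = (\<Oplus>i\<in>T. (u \<otimes> k i) \<otimes> f i s)" if s: "s \<in> S" for s
  proof -
    have sum: "(\<Oplus>i\<in>T. k i \<otimes> f i s) \<in> carrier R"
      using s fr' TS kc by (intro finsum_closed) auto
    have "u \<otimes> t \<otimes> k s = u \<otimes> (t \<otimes> k s \<ominus> (\<Oplus>i\<in>T. k i \<otimes> f i s)) \<oplus> u \<otimes> (\<Oplus>i\<in>T. k i \<otimes> f i s)"
      using u(1) fr'(3) kc[OF s] sum by (simp add: r_distr[symmetric] m_assoc minus_eq a_assoc l_neg)
    also have "\<dots> = (\<Oplus>i\<in>T. u \<otimes> (k i \<otimes> f i s))"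
      using u(2)[OF s] u(1) sum s fr' TS kc by (simp add: finsum_rdistr Pi_iff)
    also have "\<dots> = (\<Oplus>i\<in>T. (u \<otimes> k i) \<otimes> f i s)"
      using u(1) s fr' TS kc by (intro finsum_cong') (auto simp: m_assoc)
    finally show ?thesis .
  qed
  moreover have "u \<otimes> t \<in> carrier R - m"
    using u(1) fr fr' by (intro prime_mult_notin[OF m]) auto
  moreover have "(\<lambda>i. u \<otimes> k i) \<in> T \<rightarrow> carrier R" using u(1) kc TS by auto
  ultimately show ?thesis by (intro bexI[of _ "u \<otimes> t"] bexI[of _ "\<lambda>i. u \<otimes> k i"] ballI)
qed

lemma frame_values_antimono:
  assumes "r \<le> n"
  shows "frame_values n \<subseteq> frame_values r"
proof
  fix t assume "t \<in> frame_values n"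
  then obtain T f where T: "frame T t f" "card T = n" by (auto simp: frame_values_def)
  obtain T' where "T' \<subseteq> T" "card T' = r"
    using obtain_subset_with_card_n[of r T] T(2) assms by auto
  then show "t \<in> frame_values r"
    using frame_subset[OF T(1)] by (auto simp: frame_values_def)
qed

text \<open>Size 0 offers the value \<one>, and sizes are bounded by \<open>card S\<close>. The
  largest size with a value outside \<open>m\<close> is the rank of \<open>K\<close> at
  \<open>m\<close>.\<close>

lemma exists_maximal_frame:
  assumes "primeideal m R"
  shows "\<exists>T t f. frame T t f \<and> t \<notin> m \<and> frame_values (Suc (card T)) \<subseteq> m"
proof -
  define r where "r = (GREATEST r. \<not> frame_values r \<subseteq> m)"
  have 0: "\<not> frame_values 0 \<subseteq> m"
    using frame_valuesI[OF frame_empty card.empty] prime_one_notin[OF assms] by blast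
  have bound: "r \<le> card S" if "\<not> frame_values r \<subseteq> m" for r
    using that frame_carrier(1) card_mono[OF finite_index] by (auto simp: frame_values_def)
  have "\<not> frame_values r \<subseteq> m"
    unfolding r_def by (rule GreatestI_nat[of _ 0 "card S"]) (use 0 bound in auto)
  moreover have "frame_values (Suc r) \<subseteq> m"
  proof (rule ccontr)
    assume "\<not> frame_values (Suc r) \<subseteq> m"
    then have "Suc r \<le> r"
      unfolding r_def by (rule Greatest_le_nat[where b = "card S"]) (use bound in auto)
    then show False by simp
  qed
  ultimately show ?thesis unfolding frame_values_def by blast
qed

text \<open>Locally at \<open>m\<close>, the rows of a frame of size \<open>r\<close> lie in the span of fewer than \<open>r\<close> vectors,
  so over the domain \<open>R / p\<close> they satisfy a nontrivial linear relation.\<close>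

lemma frame_value_locally_nil:
  assumes m: "primeideal m R" and sub: "frame_values r \<subseteq> m" and t: "t \<in> frame_values r"
  shows "\<exists>u\<in>carrier R - m. \<forall>p. primeideal p R \<longrightarrow> u \<otimes> t \<in> p"
proof -
  obtain T f where T: "frame T t f" "card T = r" using t by (auto simp: frame_values_def)
  obtain T' t' f' where T': "frame T' t' f'" "t' \<notin> m" "frame_values (Suc (card T')) \<subseteq> m"
    using exists_maximal_frame[OF m] by blast
  note fr = frame_carrier[OF T(1)] and fr' = frame_carrier[OF T'(1)]
  have "card T' < r"
  proof (rule ccontr)
    assume "\<not> card T' < r"
    then have "t' \<in> frame_values r"
      using T'(1) frame_values_antimono[of r "card T'"] by (auto simp: frame_values_def)
    then show False using sub T'(2) by blast
  qed
  \<comment> \<open>One multiplier serves all rows of the frame, and it is fixed before any prime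
    \<open>p\<close> is considered.\<close>
  have "\<exists>u\<in>carrier R - m. \<forall>i\<in>T. \<exists>c\<in>T' \<rightarrow> carrier R. \<forall>s\<in>S. u \<otimes> f i s = (\<Oplus>j\<in>T'. c j \<otimes> f' j s)"
  proof (rule prime_common_multiplier[OF m fr(2)])
    show "\<exists>u\<in>carrier R - m. \<exists>c\<in>T' \<rightarrow> carrier R. \<forall>s\<in>S. u \<otimes> f i s = (\<Oplus>j\<in>T'. c j \<otimes> f' j s)"
      if "i \<in> T" for i
      using maximal_frame_spans[OF m T' fr(4)[OF that]] .
    show "\<exists>c\<in>T' \<rightarrow> carrier R. \<forall>s\<in>S. v \<otimes> u \<otimes> f i s = (\<Oplus>j\<in>T'. c j \<otimes> f' j s)"
      if i: "i \<in> T" and uv: "u \<in> carrier R" "v \<in> carrier R"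
        and ex: "\<exists>c\<in>T' \<rightarrow> carrier R. \<forall>s\<in>S. u \<otimes> f i s = (\<Oplus>j\<in>T'. c j \<otimes> f' j s)" for i u v
    proof -
      obtain c where c: "c \<in> T' \<rightarrow> carrier R" "\<And>s. s \<in> S \<Longrightarrow> u \<otimes> f i s = (\<Oplus>j\<in>T'. c j \<otimes> f' j s)"
        using ex by blast
      have cc: "c j \<in> carrier R" if "j \<in> T'" for j using c(1) that by blast
      have "v \<otimes> u \<otimes> f i s = (\<Oplus>j\<in>T'. (v \<otimes> c j) \<otimes> f' j s)" if s: "s \<in> S" for s
      proof -
        have "v \<otimes> u \<otimes> f i s = (\<Oplus>j\<in>T'. v \<otimes> (c j \<otimes> f' j s))"
          using uv c(2)[OF s] fr(5)[OF i s] fr' cc s by (simp add: m_assoc finsum_rdistr Pi_iff)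
        also have "\<dots> = (\<Oplus>j\<in>T'. (v \<otimes> c j) \<otimes> f' j s)"
          using uv fr' cc s by (intro finsum_cong') (auto simp: m_assoc)
        finally show ?thesis .
      qed
      moreover have "(\<lambda>j. v \<otimes> c j) \<in> T' \<rightarrow> carrier R" using uv cc by auto
      ultimately show ?thesis by (intro bexI[of _ "\<lambda>j. v \<otimes> c j"] ballI)
    qed
  qed
  then obtain u where u: "u \<in> carrier R - m"
    "\<forall>i\<in>T. \<exists>c\<in>T' \<rightarrow> carrier R. \<forall>s\<in>S. u \<otimes> f i s = (\<Oplus>j\<in>T'. c j \<otimes> f' j s)" by blast
  then obtain c where c: "\<And>i. i \<in> T \<Longrightarrow> c i \<in> T' \<rightarrow> carrier R"
    "\<And>i s. i \<in> T \<Longrightarrow> s \<in> S \<Longrightarrow> u \<otimes> f i s = (\<Oplus>j\<in>T'. c i j \<otimes> f' j s)"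
    by metis
  have cc: "c i j \<in> carrier R" if "i \<in> T" "j \<in> T'" for i j using c(1) that by blast
  have "u \<otimes> t \<in> p" if p: "primeideal p R" for p
  proof -
    have ideal: "ideal p R" using p by (rule primeideal.axioms(1))
    obtain y l where y: "y \<in> T \<rightarrow> carrier R" "l \<in> T" "y l \<notin> p" "\<And>j. j \<in> T' \<Longrightarrow> (\<Oplus>i\<in>T. y i \<otimes> c i j) \<in> p"
      using prime_left_kernel[OF p fr'(2) fr(2), of c] \<open>card T' < r\<close> T(2) cc by auto
    have yc: "y i \<in> carrier R" if "i \<in> T" for i using y(1) that by blast
    have l: "l \<in> S" using y(2) fr(1) by blast
    \<comment> \<open>Coordinate \<open>l\<close> of the combination of the rows \<open>u\<close>
      times \<open>f i\<close> with coefficients \<open>y i\<close>: the frame leaves a single term,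
      while expanded in the rows \<open>f' j\<close> the same sum has its coefficients in
      \<open>p\<close>.\<close>
    have "y l \<otimes> (u \<otimes> t) = (\<Oplus>i\<in>T. if l = i then y i \<otimes> (u \<otimes> t) else \<zero>)"
      using y(2) yc u(1) fr by (intro add.finprod_singleton[symmetric]) auto
    also have "\<dots> = (\<Oplus>i\<in>T. y i \<otimes> (u \<otimes> f i l))"
      using T(1) y(2) yc u(1) fr l by (intro finsum_cong') (auto simp: frame_def)
    also have "\<dots> = (\<Oplus>i\<in>T. \<Oplus>j\<in>T'. (y i \<otimes> c i j) \<otimes> f' j l)"
    proof (intro finsum_cong' refl Pi_I)
      fix i assume i: "i \<in> T"
      have "y i \<otimes> (u \<otimes> f i l) = (\<Oplus>j\<in>T'. y i \<otimes> (c i j \<otimes> f' j l))"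
        using c(2)[OF i l] i yc cc fr' l by (simp add: finsum_rdistr Pi_iff)
      also have "\<dots> = (\<Oplus>j\<in>T'. (y i \<otimes> c i j) \<otimes> f' j l)"
        using i yc cc fr' l by (intro finsum_cong') (auto simp: m_assoc)
      finally show "y i \<otimes> (u \<otimes> f i l) = (\<Oplus>j\<in>T'. (y i \<otimes> c i j) \<otimes> f' j l)" .
      show "(\<Oplus>j\<in>T'. (y i \<otimes> c i j) \<otimes> f' j l) \<in> carrier R"
        using i yc cc fr' l by (intro finsum_closed) auto
    qed
    also have "\<dots> = (\<Oplus>j\<in>T'. \<Oplus>i\<in>T. (y i \<otimes> c i j) \<otimes> f' j l)"
      using fr fr' yc cc l by (intro finsum_swap) auto
    also have "\<dots> = (\<Oplus>j\<in>T'. (\<Oplus>i\<in>T. y i \<otimes> c i j) \<otimes> f' j l)"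
      using fr fr' yc cc l by (intro finsum_cong' refl) (auto simp: finsum_ldistr Pi_iff intro!: finsum_closed)
    also have "\<dots> \<in> p"
      by (rule ideal_finsum_closed[OF ideal fr'(2)], rule ideal.I_r_closed[OF ideal y(4) fr'(5)]) (use l in auto)
    finally show ?thesis
      using primeideal.I_prime[OF p yc[OF y(2)], of "u \<otimes> t"] u(1) fr(3) y(3) by blast
  qed
  then show ?thesis using u(1) by blast
qed

text \<open>The elements that some multiplier outside \<open>m\<close> carries into all primes form
  an ideal, so the property passes from the frame values to the ideal they generate.\<close>

lemma ideal_frame_values_locally_nil:
  assumes m: "primeideal m R" and sub: "Idl (frame_values r) \<subseteq> m" and t: "t \<in> Idl (frame_values r)"
  shows "\<exists>u\<in>carrier R - m. \<forall>p. primeideal p R \<longrightarrow> u \<otimes> t \<in> p"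
proof -
  define N where "N = {t \<in> carrier R. \<exists>u\<in>carrier R - m. \<forall>p. primeideal p R \<longrightarrow> u \<otimes> t \<in> p}"
  have N: "\<exists>u\<in>carrier R - m. \<forall>p. primeideal p R \<longrightarrow> u \<otimes> a \<in> p" if "a \<in> N" for a
    using that by (simp add: N_def)
  have "ideal N R"
  proof (rule idealI_submodule)
    have "\<one> \<otimes> \<zero> \<in> p" if "primeideal p R" for p
      using additive_subgroup.zero_closed[OF ideal.axioms(1)[OF primeideal.axioms(1)[OF that]]] by simp
    then show "\<zero> \<in> N" using prime_one_notin[OF m] unfolding N_def by blast
    show "a \<oplus> b \<in> N" if inN: "a \<in> N" "b \<in> N" for a b
    proof -
      obtain u where u: "u \<in> carrier R - m" "\<forall>p. primeideal p R \<longrightarrow> u \<otimes> a \<in> p"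
        using N[OF inN(1)] by (rule bexE)
      obtain v where v: "v \<in> carrier R - m" "\<forall>p. primeideal p R \<longrightarrow> v \<otimes> b \<in> p"
        using N[OF inN(2)] by (rule bexE)
      have ab: "a \<in> carrier R" "b \<in> carrier R" using inN by (auto simp: N_def)
      have "u \<otimes> v \<otimes> (a \<oplus> b) \<in> p" if p: "primeideal p R" for p
      proof -
        have "v \<otimes> (u \<otimes> a) \<oplus> u \<otimes> (v \<otimes> b) \<in> p"
          using p u v ideal.I_l_closed[OF primeideal.axioms(1)[OF p]]
          by (intro additive_subgroup.a_closed[OF ideal.axioms(1)[OF primeideal.axioms(1)[OF p]]]) auto
        also have "v \<otimes> (u \<otimes> a) \<oplus> u \<otimes> (v \<otimes> b) = u \<otimes> v \<otimes> (a \<oplus> b)"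
          using u(1) v(1) ab by (simp add: r_distr m_ac)
        finally show ?thesis .
      qed
      then show ?thesis using prime_mult_notin[OF m u(1) v(1)] ab by (auto simp: N_def)
    qed
    show "x \<otimes> a \<in> N" if a: "a \<in> N" and x: "x \<in> carrier R" for a x
    proof -
      obtain u where u: "u \<in> carrier R - m" "\<forall>p. primeideal p R \<longrightarrow> u \<otimes> a \<in> p"
        using N[OF a] by (rule bexE)
      have ac: "a \<in> carrier R" using a by (auto simp: N_def)
      have "u \<otimes> (x \<otimes> a) \<in> p" if p: "primeideal p R" for p
      proof -
        have "x \<otimes> (u \<otimes> a) \<in> p"
          using u(2) p x by (intro ideal.I_l_closed[OF primeideal.axioms(1)[OF p], of "u \<otimes> a"]) auto
        also have "x \<otimes> (u \<otimes> a) = u \<otimes> (x \<otimes> a)"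
          using u(1) x ac by (simp add: m_ac)
        finally show ?thesis .
      qed
      then show ?thesis using u(1) ac x by (auto simp: N_def)
    qed
  qed (auto simp: N_def)
  moreover have "frame_values r \<subseteq> N"
  proof
    fix t assume t: "t \<in> frame_values r"
    have "frame_values r \<subseteq> m" using sub genideal_self[OF frame_values_carrier] by blast
    then show "t \<in> N"
      using frame_value_locally_nil[OF m _ t] t frame_values_carrier by (auto simp: N_def)
  qed
  ultimately have "Idl (frame_values r) \<subseteq> N" by (rule genideal_minimal)
  then show ?thesis using t by (auto simp: N_def)
qed

section \<open>From local generators to a global projection\<close>

definition fixes_rows :: "('i \<Rightarrow> 'i \<Rightarrow> 'a) \<Rightarrow> ('i \<Rightarrow> 'a) set \<Rightarrow> bool" where
  "fixes_rows a F \<longleftrightarrow> (\<forall>k\<in>F. \<forall>t\<in>S. k t = row_mult R S k a t)"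

text \<open>Stands for "\<open>F\<close> generates \<open>K\<close> at \<open>m\<close>", reduced to
  the consequence that the gluing uses, so that no localization has to be formed. The multiplier
  \<open>u\<close> may depend on \<open>k\<close> and \<open>a\<close>.\<close>

definition determines_at :: "('i \<Rightarrow> 'a) set \<Rightarrow> 'a set \<Rightarrow> bool" where
  "determines_at F m \<longleftrightarrow> (\<forall>k\<in>K. \<forall>a\<in>S \<rightarrow> K. fixes_rows a F \<longrightarrow>
    (\<exists>u\<in>carrier R - m. \<forall>t\<in>S. u \<otimes> k t = u \<otimes> row_mult R S k a t))"

lemma determines_at_mono: "determines_at F m \<Longrightarrow> F \<subseteq> F' \<Longrightarrow> determines_at F' m"
  unfolding determines_at_def fixes_rows_def by blast

text \<open>Up to a multiplier outside \<open>m\<close> every relation is a combination of the frame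
  rows, and a matrix acts linearly on rows.\<close>

lemma maximal_frame_determines:
  assumes m: "primeideal m R" and fr: "frame T t f" "t \<notin> m"
    and max: "frame_values (Suc (card T)) \<subseteq> m"
  shows "determines_at (f ` T) m"
  unfolding determines_at_def
proof (intro ballI impI)
  note fr' = frame_carrier[OF fr(1)]
  fix k a assume k: "k \<in> K" and a: "a \<in> S \<rightarrow> K" and fix_a: "fixes_rows a (f ` T)"
  have kc: "k s \<in> carrier R" if "s \<in> S" for s using k that by (rule K_carrier)
  have ac: "a s j \<in> carrier R" if "s \<in> S" "j \<in> S" for s j using K_carrier a that by blast
  obtain u c where u: "u \<in> carrier R - m" and c: "c \<in> T \<rightarrow> carrier R"
    "\<And>s. s \<in> S \<Longrightarrow> u \<otimes> k s = (\<Oplus>i\<in>T. c i \<otimes> f i s)"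
    using maximal_frame_spans[OF m fr max k] by blast
  have cc: "c i \<in> carrier R" if "i \<in> T" for i using c(1) that by blast
  have "u \<otimes> k t = u \<otimes> row_mult R S k a t" if t: "t \<in> S" for t
  proof -
    have "u \<otimes> row_mult R S k a t = row_mult R S (\<lambda>s. u \<otimes> k s) a t"
      using u kc ac t by (intro row_mult_smult[symmetric] finite_index) auto
    also have "\<dots> = row_mult R S (\<lambda>s. \<Oplus>i\<in>T. c i \<otimes> f i s) a t"
      using c(2) cc fr'(5) ac t by (intro row_mult_cong) (auto intro!: finsum_closed)
    also have "\<dots> = (\<Oplus>i\<in>T. c i \<otimes> row_mult R S (f i) a t)"
      using fr' cc ac t by (intro row_mult_finsum finite_index) auto
    also have "\<dots> = (\<Oplus>i\<in>T. c i \<otimes> f i t)"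
      using fix_a fr' cc t by (intro finsum_cong') (auto simp: fixes_rows_def)
    also have "\<dots> = u \<otimes> k t" using c(2)[OF t] by simp
    finally show ?thesis by simp
  qed
  then show "\<exists>u\<in>carrier R - m. \<forall>t\<in>S. u \<otimes> k t = u \<otimes> row_mult R S k a t" using u by blast
qed

text \<open>The relations are a direct summand: the matrix \<open>a\<close> is an idempotent with row space \<open>K\<close>.\<close>

lemma exists_projection:
  assumes Y: "Y \<subseteq> Spec R" "\<And>m. maximalideal m R \<Longrightarrow> \<exists>p\<in>Y. p \<subseteq> m"
    and chain: "acc {Y \<inter> V R f | f. f \<in> carrier R} \<or> dcc {Y \<inter> V R f | f. f \<in> carrier R}"
  shows "\<exists>a\<in>S \<rightarrow> K. \<forall>k\<in>K. \<forall>t\<in>S. k t = row_mult R S k a t"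
proof -
  let ?J = "\<lambda>r. Idl (frame_values r)"
  have J: "ideal (?J r) R" for r by (rule genideal_ideal[OF frame_values_carrier])
  have sub_J: "frame_values r \<subseteq> ?J r" for r by (rule genideal_self[OF frame_values_carrier])
  have approx: "\<exists>f\<in>?J r. \<forall>m. maximalideal m R \<longrightarrow> ?J r \<subseteq> m \<or> \<one> \<ominus> f \<in> m" for r
  proof (rule clopen_approximation[OF Y chain J])
    fix m f assume "maximalideal m R" "?J r \<subseteq> m" "f \<in> ?J r"
    then obtain u where "u \<in> carrier R - m" "\<forall>p. primeideal p R \<longrightarrow> u \<otimes> f \<in> p"
      using ideal_frame_values_locally_nil[OF maximalideal_prime] by blast
    then show "\<exists>u\<in>carrier R - m. \<forall>p\<in>Y. u \<otimes> f \<in> p"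
      using Y(1) by (intro bexI[of _ u]) (auto simp: Spec_def)
  qed
  \<comment> \<open>Scalars \<open>d\<close> for which one finite set works at all maximal ideals
    avoiding \<open>d\<close>. If \<open>d \<oplus> e\<close> avoids \<open>m\<close>, so does a
    summand; hence the union of two finite sets serves the sum and \<open>D\<close> is an ideal.
    This is quasi-compactness of the spectrum.\<close>
  define D where "D = {d \<in> carrier R. \<exists>F. finite F \<and> F \<subseteq> K \<and>
    (\<forall>m. maximalideal m R \<longrightarrow> d \<notin> m \<longrightarrow> determines_at F m)}"
  have "\<one> \<in> D"
  proof (rule one_mem_ideal_if_local)
    have maxD: "ideal m R" if "maximalideal m R" for m using that by (rule maximalideal.axioms(1))
    show "ideal D R"
    proof (rule idealI_submodule)
      have "\<zero> \<in> m" if "maximalideal m R" for m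
        using additive_subgroup.zero_closed[OF ideal.axioms(1)[OF maxD[OF that]]] .
      then show "\<zero> \<in> D" unfolding D_def by (auto intro!: exI[of _ "{}"])
      show "d \<oplus> e \<in> D" if d: "d \<in> D" and e: "e \<in> D" for d e
      proof -
        obtain F where F: "finite F" "F \<subseteq> K" "\<And>m. maximalideal m R \<Longrightarrow> d \<notin> m \<Longrightarrow> determines_at F m"
          using d unfolding D_def by auto
        obtain G where G: "finite G" "G \<subseteq> K" "\<And>m. maximalideal m R \<Longrightarrow> e \<notin> m \<Longrightarrow> determines_at G m"
          using e unfolding D_def by auto
        have "determines_at (F \<union> G) m" if m: "maximalideal m R" "d \<oplus> e \<notin> m" for m
        proof (cases "d \<in> m")
          case True
          then have "e \<notin> m"
            using m additive_subgroup.a_closed[OF ideal.axioms(1)[OF maxD[OF m(1)]]] by blast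
          then show ?thesis using determines_at_mono[OF G(3)] m(1) by blast
        next
          case False
          then show ?thesis using determines_at_mono[OF F(3)] m(1) by blast
        qed
        then show ?thesis
          using d e F(1,2) G(1,2) unfolding D_def by (auto intro!: exI[of _ "F \<union> G"])
      qed
      show "x \<otimes> d \<in> D" if d: "d \<in> D" and x: "x \<in> carrier R" for d x
      proof -
        obtain F where F: "finite F" "F \<subseteq> K" "\<And>m. maximalideal m R \<Longrightarrow> d \<notin> m \<Longrightarrow> determines_at F m"
          using d unfolding D_def by auto
        have "determines_at F m" if m: "maximalideal m R" "x \<otimes> d \<notin> m" for m
          using F(3)[OF m(1)] m(2) ideal.I_l_closed[OF maxD[OF m(1)] _ x] by blast
        then show ?thesis
          using d x F(1,2) unfolding D_def by (auto intro!: exI[of _ F])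
      qed
    qed (auto simp: D_def)
    fix m assume m: "maximalideal m R"
    have m': "primeideal m R" using m by (rule maximalideal_prime)
    obtain T t f where T: "frame T t f" "t \<notin> m" "frame_values (Suc (card T)) \<subseteq> m"
      using exists_maximal_frame[OF m'] by blast
    note fr = frame_carrier[OF T(1)]
    \<comment> \<open>Constancy of the rank near \<open>m\<close>: at a maximal ideal avoiding
      \<open>t \<otimes> (\<one> \<ominus> g)\<close> the factor \<open>t\<close> keeps the frame
      alive, and \<open>\<one> \<ominus> g\<close> forbids larger frames with values outside it. The
      product avoids \<open>m\<close> itself, because \<open>g\<close> belongs to the ideal of the
      values of size \<open>Suc (card T)\<close>, which lies in \<open>m\<close>.\<close>
    obtain g where g: "g \<in> ?J (Suc (card T))"
      "\<And>n. maximalideal n R \<Longrightarrow> ?J (Suc (card T)) \<subseteq> n \<or> \<one> \<ominus> g \<in> n"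
      using approx by blast
    have gc: "g \<in> carrier R" using ideal.Icarr[OF J g(1)] .
    have "g \<in> m" using g(1) genideal_minimal[OF maxD[OF m] T(3)] by blast
    then have "\<one> \<ominus> g \<notin> m"
      using ideal_minus_mem_iff[OF maxD[OF m] one_closed] prime_one_notin[OF m'] by blast
    then have "t \<otimes> (\<one> \<ominus> g) \<notin> m"
      using prime_mult_notin[OF m', of t "\<one> \<ominus> g"] T(2) fr(3) gc by simp
    moreover have "t \<otimes> (\<one> \<ominus> g) \<in> D"
    proof -
      have "determines_at (f ` T) n" if n: "maximalideal n R" "t \<otimes> (\<one> \<ominus> g) \<notin> n" for n
      proof (rule maximal_frame_determines[OF maximalideal_prime[OF n(1)] T(1)])
        show "t \<notin> n"
          using n(2) ideal.I_r_closed[OF maxD[OF n(1)], of t "\<one> \<ominus> g"] gc by auto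
        have "\<one> \<ominus> g \<notin> n"
          using n(2) ideal.I_l_closed[OF maxD[OF n(1)], of "\<one> \<ominus> g" t] fr(3) by auto
        then show "frame_values (Suc (card T)) \<subseteq> n" using g(2)[OF n(1)] sub_J by blast
      qed
      then show ?thesis
        using fr gc unfolding D_def by (auto intro!: exI[of _ "f ` T"])
    qed
    ultimately show "\<exists>u\<in>D. u \<notin> m" by blast
  qed
  then obtain F where F: "finite F" "F \<subseteq> K" "\<And>m. maximalideal m R \<Longrightarrow> \<one> \<notin> m \<Longrightarrow> determines_at F m"
    unfolding D_def by auto
  obtain a where a: "a \<in> S \<rightarrow> K" "fixes_rows a F"
    using pure_finite[OF F(1,2)] unfolding fixes_rows_def by blast
  have ac: "a s j \<in> carrier R" if "s \<in> S" "j \<in> S" for s j using K_carrier a(1) that by blast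
  have "k t = row_mult R S k a t" if k: "k \<in> K" and t: "t \<in> S" for k t
  proof -
    have carr: "k t \<in> carrier R" "row_mult R S k a t \<in> carrier R"
      using k t K_carrier ac by auto
    \<comment> \<open>The equation is checked at maximal ideals: the scalars after multiplication by
      which it holds form an ideal.\<close>
    let ?I = "{u \<in> carrier R. u \<otimes> k t = u \<otimes> row_mult R S k a t}"
    have "\<one> \<in> ?I"
    proof (rule one_mem_ideal_if_local)
      show "ideal ?I R"
        using carr by (intro idealI_submodule) (auto simp: l_distr m_assoc)
      fix m assume m: "maximalideal m R"
      then have "determines_at F m"
        using F(3) prime_one_notin[OF maximalideal_prime] by blast
      then show "\<exists>u\<in>?I. u \<notin> m"
        using k a t unfolding determines_at_def by blast
    qed
    then show ?thesis using carr by simp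
  qed
  then show ?thesis using a(1) by blast
qed

end

section \<open>Finitely generated modules\<close>

text \<open>The kernel of the map from R^S to \<open>M\<close>. The set \<open>S\<close> is its own
  index set: coordinate \<open>s\<close> is the coefficient of the element \<open>s\<close>.\<close>

definition relations :: "('a, 'r) ring_scheme \<Rightarrow> ('a, 'm, 's) module_scheme \<Rightarrow> 'm set \<Rightarrow> ('m \<Rightarrow> 'a) set" where
  "relations R M S = {k. (\<forall>s\<in>S. k s \<in> carrier R) \<and> (\<Oplus>\<^bsub>M\<^esub>s\<in>S. k s \<odot>\<^bsub>M\<^esub> s) = \<zero>\<^bsub>M\<^esub>}"

context module
begin

lemma smult_minus_distr:
  assumes "a \<in> carrier R" "b \<in> carrier R" "x \<in> carrier M"
  shows "(a \<ominus> b) \<odot>\<^bsub>M\<^esub> x = a \<odot>\<^bsub>M\<^esub> x \<ominus>\<^bsub>M\<^esub> b \<odot>\<^bsub>M\<^esub> x"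
  using assms by (simp add: a_minus_def smult_l_distr smult_l_minus)

lemma finsum_smult_rdistr:
  assumes "finite A" "\<And>i. i \<in> A \<Longrightarrow> c i \<in> carrier R" "x \<in> carrier M"
  shows "(\<Oplus>i\<in>A. c i) \<odot>\<^bsub>M\<^esub> x = (\<Oplus>\<^bsub>M\<^esub>i\<in>A. c i \<odot>\<^bsub>M\<^esub> x)"
  using assms(1,2)
proof (induction A rule: finite_induct)
  case (insert j A)
  then show ?case
    using assms(3) by (simp add: R.finsum_insert M.finsum_insert smult_l_distr Pi_iff R.finsum_closed)
qed (simp add: assms)

lemma combination_closed:
  assumes "S \<subseteq> carrier M" "\<And>s. s \<in> S \<Longrightarrow> k s \<in> carrier R"
  shows "(\<Oplus>\<^bsub>M\<^esub>s\<in>S. k s \<odot>\<^bsub>M\<^esub> s) \<in> carrier M"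
  using assms by (intro M.finsum_closed) auto

lemma combination_add:
  assumes "S \<subseteq> carrier M" "\<And>s. s \<in> S \<Longrightarrow> k s \<in> carrier R" "\<And>s. s \<in> S \<Longrightarrow> l s \<in> carrier R"
  shows "(\<Oplus>\<^bsub>M\<^esub>s\<in>S. (k s \<oplus> l s) \<odot>\<^bsub>M\<^esub> s)
    = (\<Oplus>\<^bsub>M\<^esub>s\<in>S. k s \<odot>\<^bsub>M\<^esub> s) \<oplus>\<^bsub>M\<^esub> (\<Oplus>\<^bsub>M\<^esub>s\<in>S. l s \<odot>\<^bsub>M\<^esub> s)"
proof -
  have "(\<Oplus>\<^bsub>M\<^esub>s\<in>S. (k s \<oplus> l s) \<odot>\<^bsub>M\<^esub> s) = (\<Oplus>\<^bsub>M\<^esub>s\<in>S. k s \<odot>\<^bsub>M\<^esub> s \<oplus>\<^bsub>M\<^esub> l s \<odot>\<^bsub>M\<^esub> s)"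
    using assms by (intro M.finsum_cong') (auto simp: smult_l_distr subset_iff)
  also have "\<dots> = (\<Oplus>\<^bsub>M\<^esub>s\<in>S. k s \<odot>\<^bsub>M\<^esub> s) \<oplus>\<^bsub>M\<^esub> (\<Oplus>\<^bsub>M\<^esub>s\<in>S. l s \<odot>\<^bsub>M\<^esub> s)"
    using assms by (intro M.finsum_addf) auto
  finally show ?thesis .
qed

lemma combination_smult:
  assumes "finite S" "S \<subseteq> carrier M" "\<And>s. s \<in> S \<Longrightarrow> k s \<in> carrier R" "x \<in> carrier R"
  shows "(\<Oplus>\<^bsub>M\<^esub>s\<in>S. (x \<otimes> k s) \<odot>\<^bsub>M\<^esub> s) = x \<odot>\<^bsub>M\<^esub> (\<Oplus>\<^bsub>M\<^esub>s\<in>S. k s \<odot>\<^bsub>M\<^esub> s)"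
proof -
  have "(\<Oplus>\<^bsub>M\<^esub>s\<in>S. (x \<otimes> k s) \<odot>\<^bsub>M\<^esub> s) = (\<Oplus>\<^bsub>M\<^esub>s\<in>S. x \<odot>\<^bsub>M\<^esub> (k s \<odot>\<^bsub>M\<^esub> s))"
    using assms by (intro M.finsum_cong') (auto simp: smult_assoc1 subset_iff)
  also have "\<dots> = x \<odot>\<^bsub>M\<^esub> (\<Oplus>\<^bsub>M\<^esub>s\<in>S. k s \<odot>\<^bsub>M\<^esub> s)"
    using assms by (intro finsum_smult_ldistr[symmetric]) auto
  finally show ?thesis .
qed

lemma combination_minus:
  assumes "finite S" "S \<subseteq> carrier M" "\<And>s. s \<in> S \<Longrightarrow> k s \<in> carrier R" "\<And>s. s \<in> S \<Longrightarrow> l s \<in> carrier R"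
  shows "(\<Oplus>\<^bsub>M\<^esub>s\<in>S. (k s \<ominus> l s) \<odot>\<^bsub>M\<^esub> s)
    = (\<Oplus>\<^bsub>M\<^esub>s\<in>S. k s \<odot>\<^bsub>M\<^esub> s) \<ominus>\<^bsub>M\<^esub> (\<Oplus>\<^bsub>M\<^esub>s\<in>S. l s \<odot>\<^bsub>M\<^esub> s)"
proof -
  have "(\<Oplus>\<^bsub>M\<^esub>s\<in>S. (k s \<ominus> l s) \<odot>\<^bsub>M\<^esub> s) = (\<Oplus>\<^bsub>M\<^esub>s\<in>S. (k s \<oplus> (\<ominus> \<one>) \<otimes> l s) \<odot>\<^bsub>M\<^esub> s)"
    using assms by (intro M.finsum_cong') (auto simp: R.minus_eq R.l_minus subset_iff)
  also have "\<dots> = (\<Oplus>\<^bsub>M\<^esub>s\<in>S. k s \<odot>\<^bsub>M\<^esub> s) \<oplus>\<^bsub>M\<^esub> (\<ominus> \<one>) \<odot>\<^bsub>M\<^esub> (\<Oplus>\<^bsub>M\<^esub>s\<in>S. l s \<odot>\<^bsub>M\<^esub> s)"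
    using assms by (simp add: combination_add combination_smult)
  finally show ?thesis
    using assms by (simp add: smult_l_minus M.minus_eq combination_closed)
qed

lemma combination_row_mult:
  assumes "finite S" "S \<subseteq> carrier M" "\<And>s. s \<in> S \<Longrightarrow> k s \<in> carrier R"
    "\<And>s t. s \<in> S \<Longrightarrow> t \<in> S \<Longrightarrow> b s t \<in> carrier R"
  shows "(\<Oplus>\<^bsub>M\<^esub>t\<in>S. row_mult R S k b t \<odot>\<^bsub>M\<^esub> t) = (\<Oplus>\<^bsub>M\<^esub>s\<in>S. k s \<odot>\<^bsub>M\<^esub> (\<Oplus>\<^bsub>M\<^esub>t\<in>S. b s t \<odot>\<^bsub>M\<^esub> t))"
proof -
  have "(\<Oplus>\<^bsub>M\<^esub>t\<in>S. row_mult R S k b t \<odot>\<^bsub>M\<^esub> t) = (\<Oplus>\<^bsub>M\<^esub>t\<in>S. \<Oplus>\<^bsub>M\<^esub>s\<in>S. (k s \<otimes> b s t) \<odot>\<^bsub>M\<^esub> t)"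
    unfolding row_mult_def using assms
    by (intro M.finsum_cong' refl) (auto simp: finsum_smult_rdistr subset_iff intro!: M.finsum_closed)
  also have "\<dots> = (\<Oplus>\<^bsub>M\<^esub>s\<in>S. \<Oplus>\<^bsub>M\<^esub>t\<in>S. (k s \<otimes> b s t) \<odot>\<^bsub>M\<^esub> t)"
    using assms by (intro M.finsum_swap) auto
  also have "\<dots> = (\<Oplus>\<^bsub>M\<^esub>s\<in>S. k s \<odot>\<^bsub>M\<^esub> (\<Oplus>\<^bsub>M\<^esub>t\<in>S. b s t \<odot>\<^bsub>M\<^esub> t))"
    using assms by (intro M.finsum_cong' refl) (auto simp: combination_smult intro!: combination_closed)
  finally show ?thesis .
qed

lemma combination_delta:
  assumes "finite S" "S \<subseteq> carrier M" "s \<in> S"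
  shows "(\<Oplus>\<^bsub>M\<^esub>t\<in>S. (if s = t then \<one> else \<zero>) \<odot>\<^bsub>M\<^esub> t) = s"
proof -
  have "(\<Oplus>\<^bsub>M\<^esub>t\<in>S. (if s = t then \<one> else \<zero>) \<odot>\<^bsub>M\<^esub> t) = (\<Oplus>\<^bsub>M\<^esub>t\<in>S. if s = t then t else \<zero>\<^bsub>M\<^esub>)"
    using assms by (intro M.finsum_cong') (auto simp: subset_iff)
  also have "\<dots> = s"
    using assms by (intro M.add.finprod_singleton[of s S "\<lambda>t. t"]) auto
  finally show ?thesis .
qed

lemma relations_cong:
  assumes k: "k \<in> relations R M S" and S: "S \<subseteq> carrier M" and eq: "\<And>s. s \<in> S \<Longrightarrow> k s = l s"
  shows "l \<in> relations R M S"
proof -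
  have "l s \<in> carrier R" if "s \<in> S" for s
    using k that eq[OF that] unfolding relations_def by force
  moreover have "(\<Oplus>\<^bsub>M\<^esub>s\<in>S. l s \<odot>\<^bsub>M\<^esub> s) = (\<Oplus>\<^bsub>M\<^esub>s\<in>S. k s \<odot>\<^bsub>M\<^esub> s)"
    using S calculation eq by (intro M.finsum_cong') auto
  ultimately show ?thesis using k by (simp add: relations_def)
qed

lemma relations_minus:
  assumes "finite S" "S \<subseteq> carrier M" "\<And>s. s \<in> S \<Longrightarrow> k s \<in> carrier R" "\<And>s. s \<in> S \<Longrightarrow> l s \<in> carrier R"
    "(\<Oplus>\<^bsub>M\<^esub>s\<in>S. k s \<odot>\<^bsub>M\<^esub> s) = (\<Oplus>\<^bsub>M\<^esub>s\<in>S. l s \<odot>\<^bsub>M\<^esub> s)"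
  shows "(\<lambda>s. k s \<ominus> l s) \<in> relations R M S"
  using assms by (simp add: relations_def combination_minus combination_closed M.r_neg M.minus_eq)

lemma pure_relations_relations:
  assumes S: "finite S" "S \<subseteq> carrier M"
    and pure: "\<And>k. k \<in> relations R M S \<Longrightarrow> \<exists>a\<in>S \<rightarrow> relations R M S. \<forall>t\<in>S. k t = row_mult R S k a t"
  shows "pure_relations R S (relations R M S)"
proof unfold_locales
  show "l \<in> relations R M S" if "k \<in> relations R M S" "\<And>s. s \<in> S \<Longrightarrow> k s = l s" for k l
    using relations_cong[OF that(1) S(2) that(2)] .
  have "(\<Oplus>\<^bsub>M\<^esub>s\<in>S. \<zero> \<odot>\<^bsub>M\<^esub> s) = (\<Oplus>\<^bsub>M\<^esub>s\<in>S. \<zero>\<^bsub>M\<^esub>)"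
    using S by (intro M.finsum_cong') auto
  then show "(\<lambda>_. \<zero>) \<in> relations R M S"
    by (simp add: relations_def M.finsum_zero)
qed (use assms in \<open>auto simp: relations_def combination_add combination_smult\<close>)

end

section \<open>Linear maps and projectivity\<close>

lemma linear_maps_closed: "f \<in> linear_maps R M N \<Longrightarrow> x \<in> carrier M \<Longrightarrow> f x \<in> carrier N"
  by (auto simp: linear_maps_def)

lemma linear_maps_combination:
  assumes "module R M" "module R N" and f: "f \<in> linear_maps R M N" and "finite T"
    and "\<And>i. i \<in> T \<Longrightarrow> e i \<in> carrier M" "\<And>i. i \<in> T \<Longrightarrow> c i \<in> carrier R"
  shows "f (\<Oplus>\<^bsub>M\<^esub>i\<in>T. c i \<odot>\<^bsub>M\<^esub> e i) = (\<Oplus>\<^bsub>N\<^esub>i\<in>T. c i \<odot>\<^bsub>N\<^esub> f (e i))"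
proof -
  interpret M: module R M by fact
  interpret N: module R N by fact
  show ?thesis
    using assms(4-)
  proof (induction T rule: finite_induct)
    case empty
    have "f (\<zero>\<^bsub>R\<^esub> \<odot>\<^bsub>M\<^esub> \<zero>\<^bsub>M\<^esub>) = \<zero>\<^bsub>R\<^esub> \<odot>\<^bsub>N\<^esub> f \<zero>\<^bsub>M\<^esub>"
      using f M.zero_closed M.R.zero_closed unfolding linear_maps_def by blast
    then show ?case using linear_maps_closed[OF f M.zero_closed] by simp
  next
    case (insert j T)
    have sum: "(\<Oplus>\<^bsub>M\<^esub>i\<in>T. c i \<odot>\<^bsub>M\<^esub> e i) \<in> carrier M"
      using insert.prems by (intro M.M.finsum_closed) auto
    have "f (\<Oplus>\<^bsub>M\<^esub>i\<in>insert j T. c i \<odot>\<^bsub>M\<^esub> e i) = f (c j \<odot>\<^bsub>M\<^esub> e j \<oplus>\<^bsub>M\<^esub> (\<Oplus>\<^bsub>M\<^esub>i\<in>T. c i \<odot>\<^bsub>M\<^esub> e i))"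
      using insert by (simp add: M.M.finsum_insert Pi_iff)
    also have "\<dots> = f (c j \<odot>\<^bsub>M\<^esub> e j) \<oplus>\<^bsub>N\<^esub> f (\<Oplus>\<^bsub>M\<^esub>i\<in>T. c i \<odot>\<^bsub>M\<^esub> e i)"
      using f sum insert.prems by (simp add: linear_maps_def)
    also have "\<dots> = c j \<odot>\<^bsub>N\<^esub> f (e j) \<oplus>\<^bsub>N\<^esub> (\<Oplus>\<^bsub>N\<^esub>i\<in>T. c i \<odot>\<^bsub>N\<^esub> f (e i))"
      using f insert by (simp add: linear_maps_def)
    also have "\<dots> = (\<Oplus>\<^bsub>N\<^esub>i\<in>insert j T. c i \<odot>\<^bsub>N\<^esub> f (e i))"
      using insert linear_maps_closed[OF f] by (simp add: N.M.finsum_insert Pi_iff)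
    finally show ?case .
  qed
qed

text \<open>Since \<open>a\<close> projects R^S onto the relations, 1 - a vanishes on them and
  induces a section from \<open>M\<close> to R^S. Lifting the values of \<open>f\<close> on the
  generators along \<open>g\<close> and composing with the section gives \<open>h\<close>.\<close>

lemma (in module) projective_if_relations_projection:
  assumes S: "finite S" "S \<subseteq> carrier M"
    and gen: "\<And>x. x \<in> carrier M \<Longrightarrow> \<exists>c\<in>S \<rightarrow> carrier R. x = (\<Oplus>\<^bsub>M\<^esub>s\<in>S. c s \<odot>\<^bsub>M\<^esub> s)"
    and a: "a \<in> S \<rightarrow> relations R M S"
    and fix_a: "\<And>k t. k \<in> relations R M S \<Longrightarrow> t \<in> S \<Longrightarrow> k t = row_mult R S k a t"
  shows "projective TYPE('n) R M"
  unfolding projective_def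
proof (intro conjI allI impI, rule module_axioms, elim conjE)
  fix E N :: "('a, 'n) module" and g f
  assume E: "module R E" and N: "module R N" and g: "g \<in> linear_maps R E N"
    and onto: "g ` carrier E = carrier N" and f: "f \<in> linear_maps R M N"
  interpret E: module R E by fact
  interpret N: module R N by fact
  have ac: "a s t \<in> carrier R" if "s \<in> S" "t \<in> S" for s t
    using a that by (auto simp: relations_def Pi_iff)
  \<comment> \<open>The matrix 1 - a. Its row \<open>s\<close> still represents the generator
    \<open>s\<close>, because row \<open>s\<close> of \<open>a\<close> is a relation; and it
    annihilates relations, because \<open>a\<close> fixes them.\<close>
  define b where "b s t = (if s = t then \<one> else \<zero>) \<ominus> a s t" for s t
  have bc: "b s t \<in> carrier R" if "s \<in> S" "t \<in> S" for s t
    using ac that by (auto simp: b_def)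
  have b_id: "(\<Oplus>\<^bsub>M\<^esub>t\<in>S. b s t \<odot>\<^bsub>M\<^esub> t) = s" if s: "s \<in> S" for s
  proof -
    have "(\<Oplus>\<^bsub>M\<^esub>t\<in>S. b s t \<odot>\<^bsub>M\<^esub> t)
        = (\<Oplus>\<^bsub>M\<^esub>t\<in>S. (if s = t then \<one> else \<zero>) \<odot>\<^bsub>M\<^esub> t) \<ominus>\<^bsub>M\<^esub> (\<Oplus>\<^bsub>M\<^esub>t\<in>S. a s t \<odot>\<^bsub>M\<^esub> t)"
      unfolding b_def using S ac s by (intro combination_minus) auto
    also have "(\<Oplus>\<^bsub>M\<^esub>t\<in>S. a s t \<odot>\<^bsub>M\<^esub> t) = \<zero>\<^bsub>M\<^esub>"
      using a s by (auto simp: relations_def Pi_iff)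
    finally show ?thesis using S s by (simp add: combination_delta M.minus_eq subset_iff)
  qed
  have b_zero: "row_mult R S k b t = \<zero>" if k: "k \<in> relations R M S" and t: "t \<in> S" for k t
  proof -
    have kc: "k s \<in> carrier R" if "s \<in> S" for s using k that by (simp add: relations_def)
    have "row_mult R S k b t = (\<Oplus>s\<in>S. (if t = s then k s else \<zero>) \<oplus> (\<ominus> \<one>) \<otimes> (k s \<otimes> a s t))"
      unfolding row_mult_def b_def using kc ac t
      by (intro R.finsum_cong') (auto simp: R.minus_eq R.l_minus R.r_minus R.r_distr)
    also have "\<dots> = (\<Oplus>s\<in>S. if t = s then k s else \<zero>) \<oplus> (\<ominus> \<one>) \<otimes> row_mult R S k a t"
      unfolding row_mult_def using kc ac t S by (simp add: R.finsum_addf R.finsum_rdistr Pi_iff)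
    also have "(\<Oplus>s\<in>S. if t = s then k s else \<zero>) = k t"
      using kc t S by (intro R.add.finprod_singleton) auto
    finally show ?thesis using fix_a[OF k t] kc[OF t] by (simp add: R.l_minus R.r_neg)
  qed
  have "\<forall>t. \<exists>y. t \<in> S \<longrightarrow> y \<in> carrier E \<and> g y = f t"
  proof (intro allI)
    fix t
    show "\<exists>y. t \<in> S \<longrightarrow> y \<in> carrier E \<and> g y = f t"
    proof (cases "t \<in> S")
      case True
      then have "f t \<in> g ` carrier E" using linear_maps_closed[OF f] S onto by blast
      then show ?thesis by auto
    qed simp
  qed
  then obtain e where e: "\<And>t. t \<in> S \<Longrightarrow> e t \<in> carrier E" "\<And>t. t \<in> S \<Longrightarrow> g (e t) = f t"
    by metis
  obtain coef where coef: "\<And>x s. x \<in> carrier M \<Longrightarrow> s \<in> S \<Longrightarrow> coef x s \<in> carrier R"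
    "\<And>x. x \<in> carrier M \<Longrightarrow> x = (\<Oplus>\<^bsub>M\<^esub>s\<in>S. coef x s \<odot>\<^bsub>M\<^esub> s)"
  proof -
    have "\<forall>x. \<exists>c. x \<in> carrier M \<longrightarrow> c \<in> S \<rightarrow> carrier R \<and> x = (\<Oplus>\<^bsub>M\<^esub>s\<in>S. c s \<odot>\<^bsub>M\<^esub> s)"
      using gen by blast
    then obtain c where c: "\<forall>x. x \<in> carrier M \<longrightarrow> c x \<in> S \<rightarrow> carrier R \<and> x = (\<Oplus>\<^bsub>M\<^esub>s\<in>S. c x s \<odot>\<^bsub>M\<^esub> s)"
      by (rule choice[THEN exE])
    show ?thesis by (rule that[of c]) (use c in blast)+
  qed
  define h where "h x = (\<Oplus>\<^bsub>E\<^esub>t\<in>S. row_mult R S (coef x) b t \<odot>\<^bsub>E\<^esub> e t)" for x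
  have rc: "row_mult R S d b t \<in> carrier R" if "\<And>s. s \<in> S \<Longrightarrow> d s \<in> carrier R" "t \<in> S" for d t
    using that bc by simp
  \<comment> \<open>Two coefficient vectors of \<open>x\<close> differ by a relation, which
    \<open>b\<close> kills. So \<open>h\<close> is linear although the choice \<open>coef\<close>
    need not be.\<close>
  have h_eq: "h x = (\<Oplus>\<^bsub>E\<^esub>t\<in>S. row_mult R S d b t \<odot>\<^bsub>E\<^esub> e t)"
    if x: "x = (\<Oplus>\<^bsub>M\<^esub>s\<in>S. d s \<odot>\<^bsub>M\<^esub> s)" and d: "\<And>s. s \<in> S \<Longrightarrow> d s \<in> carrier R" for x d
    unfolding h_def
  proof (intro E.M.finsum_cong' refl)
    have xM: "x \<in> carrier M" unfolding x using S(2) d by (rule combination_closed)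
    note c = coef(1)[OF xM]
    fix t assume t: "t \<in> S"
    have "(\<lambda>s. coef x s \<ominus> d s) \<in> relations R M S"
      using coef(2)[OF xM] x by (intro relations_minus S c d) simp_all
    from b_zero[OF this t] have "row_mult R S (coef x) b t \<ominus> row_mult R S d b t = \<zero>"
      using R.row_mult_minus[OF S(1), of "coef x" d b t] c d bc t by simp
    then have "row_mult R S (coef x) b t = row_mult R S d b t"
      using rc c d t by (simp add: R.r_right_minus_eq)
    then show "row_mult R S (coef x) b t \<odot>\<^bsub>E\<^esub> e t = row_mult R S d b t \<odot>\<^bsub>E\<^esub> e t" by simp
  qed (use e rc d in auto)
  have h_closed: "h x \<in> carrier E" if "x \<in> carrier M" for x
    unfolding h_def using e rc coef(1) that by (intro E.M.finsum_closed) auto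
  have "h \<in> linear_maps R M E"
    unfolding linear_maps_def
  proof (intro CollectI conjI ballI)
    show "h \<in> carrier M \<rightarrow> carrier E" using h_closed by blast
    show "h (x \<oplus>\<^bsub>M\<^esub> y) = h x \<oplus>\<^bsub>E\<^esub> h y" if x: "x \<in> carrier M" and y: "y \<in> carrier M" for x y
    proof -
      note c = coef(1)[OF x] coef(1)[OF y]
      have "h (x \<oplus>\<^bsub>M\<^esub> y) = (\<Oplus>\<^bsub>E\<^esub>t\<in>S. row_mult R S (\<lambda>s. coef x s \<oplus> coef y s) b t \<odot>\<^bsub>E\<^esub> e t)"
        using c S coef(2)[OF x, symmetric] coef(2)[OF y, symmetric] by (intro h_eq) (simp_all add: combination_add)
      also have "\<dots> = (\<Oplus>\<^bsub>E\<^esub>t\<in>S. row_mult R S (coef x) b t \<odot>\<^bsub>E\<^esub> e t \<oplus>\<^bsub>E\<^esub> row_mult R S (coef y) b t \<odot>\<^bsub>E\<^esub> e t)"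
        using c e bc by (intro E.M.finsum_cong') (auto simp: R.row_mult_add E.smult_l_distr)
      also have "\<dots> = h x \<oplus>\<^bsub>E\<^esub> h y"
        unfolding h_def using c e rc by (intro E.M.finsum_addf) auto
      finally show ?thesis .
    qed
    show "h (r \<odot>\<^bsub>M\<^esub> x) = r \<odot>\<^bsub>E\<^esub> h x" if r: "r \<in> carrier R" and x: "x \<in> carrier M" for r x
    proof -
      note c = coef(1)[OF x]
      have "h (r \<odot>\<^bsub>M\<^esub> x) = (\<Oplus>\<^bsub>E\<^esub>t\<in>S. row_mult R S (\<lambda>s. r \<otimes> coef x s) b t \<odot>\<^bsub>E\<^esub> e t)"
        using c r S coef(2)[OF x, symmetric] by (intro h_eq) (simp_all add: combination_smult)
      also have "\<dots> = (\<Oplus>\<^bsub>E\<^esub>t\<in>S. r \<odot>\<^bsub>E\<^esub> (row_mult R S (coef x) b t \<odot>\<^bsub>E\<^esub> e t))"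
        using c e bc r S by (intro E.M.finsum_cong') (auto simp: R.row_mult_smult E.smult_assoc1)
      also have "\<dots> = r \<odot>\<^bsub>E\<^esub> h x"
        unfolding h_def using c e rc r S by (intro E.finsum_smult_ldistr[symmetric]) auto
      finally show ?thesis .
    qed
  qed
  moreover have "g (h x) = f x" if x: "x \<in> carrier M" for x
  proof -
    note c = coef(1)[OF x]
    have "g (h x) = (\<Oplus>\<^bsub>N\<^esub>t\<in>S. row_mult R S (coef x) b t \<odot>\<^bsub>N\<^esub> g (e t))"
      unfolding h_def using e c rc by (intro linear_maps_combination[OF E N g S(1)]) auto
    also have "\<dots> = (\<Oplus>\<^bsub>N\<^esub>t\<in>S. row_mult R S (coef x) b t \<odot>\<^bsub>N\<^esub> f t)"
      using e c rc linear_maps_closed[OF f] S by (intro N.M.finsum_cong') auto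
    also have "\<dots> = f (\<Oplus>\<^bsub>M\<^esub>t\<in>S. row_mult R S (coef x) b t \<odot>\<^bsub>M\<^esub> t)"
      using S c rc by (intro linear_maps_combination[OF module_axioms N f S(1), symmetric]) auto
    also have "(\<Oplus>\<^bsub>M\<^esub>t\<in>S. row_mult R S (coef x) b t \<odot>\<^bsub>M\<^esub> t) = (\<Oplus>\<^bsub>M\<^esub>s\<in>S. coef x s \<odot>\<^bsub>M\<^esub> (\<Oplus>\<^bsub>M\<^esub>t\<in>S. b s t \<odot>\<^bsub>M\<^esub> t))"
      using S c bc by (intro combination_row_mult) auto
    also have "\<dots> = (\<Oplus>\<^bsub>M\<^esub>s\<in>S. coef x s \<odot>\<^bsub>M\<^esub> s)"
      using S c b_id by (intro M.finsum_cong') auto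
    also have "\<dots> = x" using coef(2)[OF x] by simp
    finally show ?thesis .
  qed
  ultimately show "\<exists>h\<in>linear_maps R M E. \<forall>x\<in>carrier M. g (h x) = f x" by blast
qed

section \<open>Flatness\<close>

text \<open>Flatness is tested on modules with elements of type \<open>'a list set\<close>, so an ideal is copied to
  that type along \<open>x \<mapsto> {[x]}\<close>.\<close>

definition singleton_module :: "('a, 'r) ring_scheme \<Rightarrow> 'a set \<Rightarrow> ('a, 'a list set) module" where
  "singleton_module R I = \<lparr>carrier = (\<lambda>x. {[x]}) ` I,
     monoid.mult = undefined, one = {[\<one>\<^bsub>R\<^esub>]}, ring.zero = {[\<zero>\<^bsub>R\<^esub>]},
     ring.add = (\<lambda>u v. {[hd (the_elem u) \<oplus>\<^bsub>R\<^esub> hd (the_elem v)]}),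
     module.smult = (\<lambda>a u. {[a \<otimes>\<^bsub>R\<^esub> hd (the_elem u)]})\<rparr>"

lemma singleton_module_simps [simp]:
  "carrier (singleton_module R I) = (\<lambda>x. {[x]}) ` I"
  "\<zero>\<^bsub>singleton_module R I\<^esub> = {[\<zero>\<^bsub>R\<^esub>]}"
  "{[x]} \<oplus>\<^bsub>singleton_module R I\<^esub> {[y]} = {[x \<oplus>\<^bsub>R\<^esub> y]}"
  "a \<odot>\<^bsub>singleton_module R I\<^esub> {[x]} = {[a \<otimes>\<^bsub>R\<^esub> x]}"
  by (simp_all add: singleton_module_def)

lemma (in cring) module_singleton_module:
  assumes "ideal I R"
  shows "module R (singleton_module R I)"
proof -
  interpret ideal I R by fact
  show ?thesis
  proof (rule moduleI[OF is_cring])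
    show "abelian_group (singleton_module R I)"
    proof (rule abelian_groupI)
      fix A assume "A \<in> carrier (singleton_module R I)"
      then obtain x where x: "x \<in> I" "A = {[x]}" by auto
      then have "{[\<ominus> x]} \<in> carrier (singleton_module R I)" by simp
      moreover have "{[\<ominus> x]} \<oplus>\<^bsub>singleton_module R I\<^esub> A = \<zero>\<^bsub>singleton_module R I\<^esub>"
        using x by (simp add: l_neg)
      ultimately show "\<exists>Z\<in>carrier (singleton_module R I).
          Z \<oplus>\<^bsub>singleton_module R I\<^esub> A = \<zero>\<^bsub>singleton_module R I\<^esub>" by blast
    qed (auto simp: a_ac)
  qed (auto simp: I_l_closed l_distr r_distr m_assoc)
qed

lemma (in comm_group) hom_free_Abelian_group_diff:
  assumes "h \<in> hom (free_Abelian_group A) G"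
    "u \<in> carrier (free_Abelian_group A)" "v \<in> carrier (free_Abelian_group A)"
  shows "h (u - v) = h u \<otimes> inv (h v)"
proof -
  interpret h: group_hom "free_Abelian_group A" G h
    using assms(1) by (simp add: group_hom_def group_hom_axioms_def)
  have "u - v = u \<otimes>\<^bsub>free_Abelian_group A\<^esub> inv\<^bsub>free_Abelian_group A\<^esub> v"
    using assms by simp
  moreover have "h (u \<otimes>\<^bsub>free_Abelian_group A\<^esub> inv\<^bsub>free_Abelian_group A\<^esub> v) = h u \<otimes> inv (h v)"
    using assms(2,3) h.hom_mult h.hom_inv h.G.inv_closed by metis
  ultimately show ?thesis by (simp only:)
qed

text \<open>The submodule \<open>L M\<close> of \<open>M\<^sup>S\<close>, for \<open>L\<close> the module of relations between the scalars \<open>r s\<close>; the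
  quotient of \<open>M\<^sup>S\<close> by it is \<open>I \<otimes> M\<close>, where \<open>I\<close> is the ideal generated by the \<open>r s\<close>.\<close>

definition syzygy_combinations ::
    "('a, 'r) ring_scheme \<Rightarrow> ('a, 'm, 's) module_scheme \<Rightarrow> 'm set \<Rightarrow> ('m \<Rightarrow> 'a) \<Rightarrow> ('m \<Rightarrow> 'm) set" where
  "syzygy_combinations R M S r = {v. \<exists>b. (\<forall>s\<in>S. \<forall>t\<in>S. b s t \<in> carrier R) \<and>
     (\<forall>t\<in>S. row_mult R S r b t = \<zero>\<^bsub>R\<^esub>) \<and> (\<forall>s\<in>S. v s = (\<Oplus>\<^bsub>M\<^esub>t\<in>S. b s t \<odot>\<^bsub>M\<^esub> t))}"

context module
begin

lemma syzygy_combinationsI: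
  assumes "\<And>s t. s \<in> S \<Longrightarrow> t \<in> S \<Longrightarrow> b s t \<in> carrier R" "\<And>t. t \<in> S \<Longrightarrow> row_mult R S r b t = \<zero>"
    "\<And>s. s \<in> S \<Longrightarrow> v s = (\<Oplus>\<^bsub>M\<^esub>t\<in>S. b s t \<odot>\<^bsub>M\<^esub> t)"
  shows "v \<in> syzygy_combinations R M S r"
  using assms unfolding syzygy_combinations_def by blast

lemma syzygy_combinations_cong:
  assumes "v \<in> syzygy_combinations R M S r" "\<And>s. s \<in> S \<Longrightarrow> v s = w s"
  shows "w \<in> syzygy_combinations R M S r"
  using assms unfolding syzygy_combinations_def by auto

lemma syzygy_combinations_minus:
  assumes S: "finite S" "S \<subseteq> carrier M" and r: "\<And>s. s \<in> S \<Longrightarrow> r s \<in> carrier R"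
    and v: "v \<in> syzygy_combinations R M S r" and w: "w \<in> syzygy_combinations R M S r"
  shows "(\<lambda>s. v s \<ominus>\<^bsub>M\<^esub> w s) \<in> syzygy_combinations R M S r"
proof -
  obtain b where b: "\<And>s t. s \<in> S \<Longrightarrow> t \<in> S \<Longrightarrow> b s t \<in> carrier R" "\<And>t. t \<in> S \<Longrightarrow> row_mult R S r b t = \<zero>"
    "\<And>s. s \<in> S \<Longrightarrow> v s = (\<Oplus>\<^bsub>M\<^esub>t\<in>S. b s t \<odot>\<^bsub>M\<^esub> t)"
    using v unfolding syzygy_combinations_def by blast
  obtain c where c: "\<And>s t. s \<in> S \<Longrightarrow> t \<in> S \<Longrightarrow> c s t \<in> carrier R" "\<And>t. t \<in> S \<Longrightarrow> row_mult R S r c t = \<zero>"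
    "\<And>s. s \<in> S \<Longrightarrow> w s = (\<Oplus>\<^bsub>M\<^esub>t\<in>S. c s t \<odot>\<^bsub>M\<^esub> t)"
    using w unfolding syzygy_combinations_def by blast
  show ?thesis
  proof (rule syzygy_combinationsI[where b = "\<lambda>s t. b s t \<ominus> c s t"])
    fix t assume t: "t \<in> S"
    have "row_mult R S r (\<lambda>s t. b s t \<ominus> c s t) t = (\<Oplus>s\<in>S. r s \<otimes> b s t \<oplus> (\<ominus> \<one>) \<otimes> (r s \<otimes> c s t))"
      unfolding row_mult_def using b(1) c(1) r t
      by (intro R.finsum_cong') (auto simp: R.minus_eq R.l_minus R.r_minus R.r_distr)
    also have "\<dots> = row_mult R S r b t \<oplus> (\<ominus> \<one>) \<otimes> row_mult R S r c t"
      unfolding row_mult_def using b(1) c(1) r t S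
      by (simp add: R.finsum_addf R.finsum_rdistr Pi_iff)
    finally show "row_mult R S r (\<lambda>s t. b s t \<ominus> c s t) t = \<zero>" using b(2)[OF t] c(2)[OF t] by simp
  qed (use S b c in \<open>simp_all add: combination_minus\<close>)
qed

text \<open>The witness is the rank one matrix formed by the column \<open>l\<close> and the row
  \<open>d\<close>; \<open>r\<close> annihilates it because it annihilates \<open>l\<close>.\<close>

lemma syzygy_combinations_smult:
  assumes S: "finite S" "S \<subseteq> carrier M" and r: "\<And>s. s \<in> S \<Longrightarrow> r s \<in> carrier R"
    and gen: "x = (\<Oplus>\<^bsub>M\<^esub>s\<in>S. d s \<odot>\<^bsub>M\<^esub> s)" "\<And>s. s \<in> S \<Longrightarrow> d s \<in> carrier R"
    and l: "\<And>s. s \<in> S \<Longrightarrow> l s \<in> carrier R" "(\<Oplus>s\<in>S. r s \<otimes> l s) = \<zero>"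
  shows "(\<lambda>s. l s \<odot>\<^bsub>M\<^esub> x) \<in> syzygy_combinations R M S r"
proof (rule syzygy_combinationsI[where b = "\<lambda>s t. l s \<otimes> d t"])
  fix t assume t: "t \<in> S"
  have "row_mult R S r (\<lambda>s t. l s \<otimes> d t) t = (\<Oplus>s\<in>S. r s \<otimes> l s \<otimes> d t)"
    unfolding row_mult_def using r l t gen by (intro R.finsum_cong') (auto simp: R.m_assoc)
  also have "\<dots> = (\<Oplus>s\<in>S. r s \<otimes> l s) \<otimes> d t"
    using r l t gen S by (intro R.finsum_ldistr[symmetric]) auto
  finally show "row_mult R S r (\<lambda>s t. l s \<otimes> d t) t = \<zero>" using l(2) t gen by simp
qed (use S l gen in \<open>simp_all add: combination_smult\<close>)

end

section \<open>Computing modulo the tensor relations\<close>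

lemma pair_map_ident: "pair_map (\<lambda>x. x) u = u" for u :: "'k \<times> 'm \<Rightarrow>\<^sub>0 int"
proof -
  have "frag_extend (\<lambda>p. frag_of p) u = u" by (simp flip: frag_expansion)
  moreover have "(\<lambda>p. frag_of p) = (\<lambda>(x, m). (frag_of (x, m)) :: 'k \<times> 'm \<Rightarrow>\<^sub>0 int)" by auto
  ultimately show ?thesis unfolding pair_map_def by simp
qed

lemma pair_map_zero: "pair_map f 0 = 0"
  by (simp add: pair_map_def)

lemma tensor_rels_subset_sub: "tensor_rels R N M \<subseteq> tensor_sub R N M"
  unfolding tensor_sub_def by (auto intro: generate.incl)

context module
begin

lemma tensor_sub_closed:
  assumes "module R N"
  shows "0 \<in> tensor_sub R N M"
    and "u \<in> tensor_sub R N M \<Longrightarrow> v \<in> tensor_sub R N M \<Longrightarrow> u + v \<in> tensor_sub R N M"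
    and "u \<in> tensor_sub R N M \<Longrightarrow> - u \<in> tensor_sub R N M"
    and "u \<in> tensor_sub R N M \<Longrightarrow> v \<in> tensor_sub R N M \<Longrightarrow> u - v \<in> tensor_sub R N M"
proof -
  interpret T: normal "tensor_sub R N M" "tensor_free N M"
    by (rule tensor_sub_normal[OF assms module_axioms])
  show "0 \<in> tensor_sub R N M" using subgroup.one_closed[OF T.subgroup_axioms] by simp
  show add: "u + v \<in> tensor_sub R N M" if "u \<in> tensor_sub R N M" "v \<in> tensor_sub R N M" for u v
    using subgroup.m_closed[OF T.subgroup_axioms that] by simp
  show neg: "- u \<in> tensor_sub R N M" if "u \<in> tensor_sub R N M" for u
    using subgroup.m_inv_closed[OF T.subgroup_axioms that] T.mem_carrier[OF that] by simp
  show "u - v \<in> tensor_sub R N M" if "u \<in> tensor_sub R N M" "v \<in> tensor_sub R N M"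
    using add[OF that(1) neg[OF that(2)]] by simp
qed

lemma tensor_sub_zero_right:
  assumes N: "module R N" and x: "x \<in> carrier N"
  shows "frag_of (x, \<zero>\<^bsub>M\<^esub>) \<in> tensor_sub R N M"
proof -
  have "frag_of (x, \<zero>\<^bsub>M\<^esub> \<oplus>\<^bsub>M\<^esub> \<zero>\<^bsub>M\<^esub>) - frag_of (x, \<zero>\<^bsub>M\<^esub>) - frag_of (x, \<zero>\<^bsub>M\<^esub>) \<in> tensor_rels R N M"
    unfolding tensor_rels_def using x M.zero_closed by blast
  then have "- frag_of (x, \<zero>\<^bsub>M\<^esub>) \<in> tensor_sub R N M"
    using tensor_rels_subset_sub by auto
  then show ?thesis using tensor_sub_closed(3)[OF N] by fastforce
qed

lemma tensor_sub_finsum_right: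
  assumes N: "module R N" and x: "x \<in> carrier N" and "finite A" "\<And>i. i \<in> A \<Longrightarrow> m i \<in> carrier M"
  shows "(\<Sum>i\<in>A. frag_of (x, m i)) - frag_of (x, \<Oplus>\<^bsub>M\<^esub>i\<in>A. m i) \<in> tensor_sub R N M"
  using assms(3,4)
proof (induction A rule: finite_induct)
  case empty
  then show ?case
    using tensor_sub_closed(3)[OF N tensor_sub_zero_right[OF N x]] by simp
next
  case (insert j A)
  define s where "s = (\<Oplus>\<^bsub>M\<^esub>i\<in>A. m i)"
  have s: "s \<in> carrier M" unfolding s_def using insert.prems by (intro M.finsum_closed) auto
  have "frag_of (x, m j \<oplus>\<^bsub>M\<^esub> s) - frag_of (x, m j) - frag_of (x, s) \<in> tensor_rels R N M"
    unfolding tensor_rels_def using x s insert.prems by blast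
  then have "frag_of (x, m j \<oplus>\<^bsub>M\<^esub> s) - frag_of (x, m j) - frag_of (x, s) \<in> tensor_sub R N M"
    using tensor_rels_subset_sub by blast
  moreover have "(\<Sum>i\<in>A. frag_of (x, m i)) - frag_of (x, s) \<in> tensor_sub R N M"
    using insert unfolding s_def by blast
  ultimately have "(\<Sum>i\<in>A. frag_of (x, m i)) - frag_of (x, s)
      - (frag_of (x, m j \<oplus>\<^bsub>M\<^esub> s) - frag_of (x, m j) - frag_of (x, s)) \<in> tensor_sub R N M"
    by (rule tensor_sub_closed(4)[OF N, rotated])
  moreover have "(\<Oplus>\<^bsub>M\<^esub>i\<in>insert j A. m i) = m j \<oplus>\<^bsub>M\<^esub> s"
    unfolding s_def using insert by (simp add: M.finsum_insert Pi_iff)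
  ultimately show ?case using insert.hyps by (simp add: algebra_simps)
qed

lemma tensor_coset_eq_iff:
  assumes N: "module R N" and u: "u \<in> carrier (tensor_free N M)"
  shows "tensor_sub R N M #>\<^bsub>tensor_free N M\<^esub> u = tensor_sub R N M \<longleftrightarrow> u \<in> tensor_sub R N M"
proof -
  interpret T: normal "tensor_sub R N M" "tensor_free N M"
    by (rule tensor_sub_normal[OF N module_axioms])
  show ?thesis
    using T.rcos_self[OF u T.subgroup_axioms] T.coset_join2[OF u T.subgroup_axioms] by auto
qed

text \<open>Injectivity in kernel form, on formal sums: the cosets of \<open>u\<close> and of 0 have
  the same image and therefore agree.\<close>

lemma tensor_sub_reflected:
  assumes f: "f \<in> linear_maps R K N" and K: "module R K" and N: "module R N"
    and inj: "inj_on (tensor_map R N M f) (carrier (tensor R K M))"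
    and u: "u \<in> carrier (tensor_free K M)" "pair_map f u \<in> tensor_sub R N M"
  shows "u \<in> tensor_sub R K M"
proof -
  let ?c = "\<lambda>v. tensor_sub R K M #>\<^bsub>tensor_free K M\<^esub> v"
  have 0: "0 \<in> carrier (tensor_free K M)" by simp
  have carr: "?c v \<in> carrier (tensor R K M)" if "v \<in> carrier (tensor_free K M)" for v
    using that by (auto simp: tensor_def FactGroup_def RCOSETS_def)
  have f_closed: "f \<in> carrier K \<rightarrow> carrier N" using f by (simp add: linear_maps_def)
  have "tensor_map R N M f (?c u) = tensor_map R N M f (?c 0)"
    unfolding tensor_map_coset[OF f K N module_axioms u(1)] tensor_map_coset[OF f K N module_axioms 0]
    using tensor_coset_eq_iff[OF N pair_map_closed[OF f_closed u(1)]] u(2)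
      tensor_coset_eq_iff[OF N, of 0] tensor_sub_closed(1)[OF N] by (simp add: pair_map_zero)
  then have "?c u = ?c 0" using inj carr u(1) 0 by (meson inj_onD)
  also have "\<dots> = tensor_sub R K M"
    using tensor_coset_eq_iff[OF K 0] tensor_sub_closed(1)[OF K] by simp
  finally show ?thesis using tensor_coset_eq_iff[OF K u(1)] by simp
qed

text \<open>In R \<otimes> M scalars move across: the sum of the k s \<otimes> s equals 1 \<otimes>
  x with x the combination of the generators, and x = 0 for a relation.\<close>

lemma combination_tensor_sub:
  assumes "finite S" "S \<subseteq> carrier M" and k: "k \<in> relations R M S"
  shows "(\<Sum>s\<in>S. frag_of ({[k s]}, s)) \<in> tensor_sub R (singleton_module R (carrier R)) M"
proof -
  let ?N = "singleton_module R (carrier R)"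
  have N: "module R ?N" by (rule R.module_singleton_module[OF R.oneideal])
  have kc: "k s \<in> carrier R" if "s \<in> S" for s using k that by (simp add: relations_def)
  have one: "{[\<one>]} \<in> carrier ?N" by simp
  have rel: "frag_of ({[k s]}, s) - frag_of ({[\<one>]}, k s \<odot>\<^bsub>M\<^esub> s) \<in> tensor_sub R ?N M" if s: "s \<in> S" for s
  proof -
    have "frag_of (k s \<odot>\<^bsub>?N\<^esub> {[\<one>]}, s) - frag_of ({[\<one>]}, k s \<odot>\<^bsub>M\<^esub> s) \<in> tensor_rels R ?N M"
      unfolding tensor_rels_def using kc[OF s] s assms(2) one by blast
    then show ?thesis using tensor_rels_subset_sub kc[OF s] by auto
  qed
  have "(\<Sum>s\<in>A. frag_of ({[k s]}, s) - frag_of ({[\<one>]}, k s \<odot>\<^bsub>M\<^esub> s)) \<in> tensor_sub R ?N M"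
    if "A \<subseteq> S" for A
    using finite_subset[OF that assms(1)] that
  proof (induction A rule: finite_induct)
    case (insert j A)
    then show ?case using rel[of j] tensor_sub_closed(2)[OF N] by simp
  qed (simp add: tensor_sub_closed(1)[OF N])
  from this[OF subset_refl]
  have 1: "(\<Sum>s\<in>S. frag_of ({[k s]}, s)) - (\<Sum>s\<in>S. frag_of ({[\<one>]}, k s \<odot>\<^bsub>M\<^esub> s)) \<in> tensor_sub R ?N M"
    by (simp add: sum_subtractf)
  have 2: "(\<Sum>s\<in>S. frag_of ({[\<one>]}, k s \<odot>\<^bsub>M\<^esub> s)) - frag_of ({[\<one>]}, \<Oplus>\<^bsub>M\<^esub>s\<in>S. k s \<odot>\<^bsub>M\<^esub> s) \<in> tensor_sub R ?N M"
    using assms kc by (intro tensor_sub_finsum_right[OF N one]) auto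
  have "frag_of ({[\<one>]}, \<Oplus>\<^bsub>M\<^esub>s\<in>S. k s \<odot>\<^bsub>M\<^esub> s) \<in> tensor_sub R ?N M"
    using k tensor_sub_zero_right[OF N one] by (simp add: relations_def)
  from tensor_sub_closed(2)[OF N tensor_sub_closed(2)[OF N 1 2] this] show ?thesis
    by simp
qed

text \<open>The equational criterion for flatness, from the inclusion into R of the ideal
  \<open>I\<close> generated by the \<open>r s\<close>. The element \<open>u\<close>, the sum of the
  r s \<otimes> s, vanishes in R \<otimes> M and hence in I \<otimes> M. Sending x \<otimes> m to
  the vector with entries \<open>c x s\<close> times m, for chosen coefficients \<open>c x\<close>
  of x, is well defined into M^S modulo syzygy combinations, and up to these it sends
  \<open>u\<close> to the vector of generators.\<close>

lemma flat_syzygies: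
  assumes S: "finite S" "S \<subseteq> carrier M"
    and gen: "\<And>x. x \<in> carrier M \<Longrightarrow> \<exists>c\<in>S \<rightarrow> carrier R. x = (\<Oplus>\<^bsub>M\<^esub>s\<in>S. c s \<odot>\<^bsub>M\<^esub> s)"
    and flat: "flat TYPE('a list set) R M" and r: "r \<in> relations R M S"
  shows "(\<lambda>s. s) \<in> syzygy_combinations R M S r"
proof -
  have rc: "r s \<in> carrier R" if "s \<in> S" for s using r that by (simp add: relations_def)
  define I where "I = {\<Oplus>s\<in>S. r s \<otimes> c s | c. c \<in> S \<rightarrow> carrier R}"
  have I: "ideal I R" unfolding I_def using S rc by (intro R.ideal_linear_combinations)
  have Ic: "x \<in> carrier R" if "x \<in> I" for x using ideal.Icarr[OF I that] .
  let ?N = "singleton_module R (carrier R)" and ?K = "singleton_module R I"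
  have N: "module R ?N" by (rule R.module_singleton_module[OF R.oneideal])
  have K: "module R ?K" by (rule R.module_singleton_module[OF I])
  have delta: "(\<Oplus>s\<in>S. r s \<otimes> (if t = s then \<one> else \<zero>)) = r t" if t: "t \<in> S" for t
  proof -
    have "(\<Oplus>s\<in>S. r s \<otimes> (if t = s then \<one> else \<zero>)) = (\<Oplus>s\<in>S. if t = s then r s else \<zero>)"
      using rc by (intro R.finsum_cong') auto
    also have "\<dots> = r t" using rc t S by (intro R.add.finprod_singleton) auto
    finally show ?thesis .
  qed
  have rI: "r t \<in> I" if "t \<in> S" for t
    unfolding I_def using delta[OF that] by (intro CollectI exI[of _ "\<lambda>s. if t = s then \<one> else \<zero>"]) auto
  define u where "u = (\<Sum>s\<in>S. frag_of ({[r s]}, s))"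
  have u_carr: "u \<in> carrier (tensor_free ?K M)"
    unfolding u_def using rI S by (intro sum_closed_free_Abelian_group) auto
  have u: "u \<in> tensor_sub R ?K M"
  proof (rule tensor_sub_reflected[OF _ K N _ u_carr])
    show f: "(\<lambda>x. x) \<in> linear_maps R ?K ?N" using Ic by (auto simp: linear_maps_def)
    have "inj_on (\<lambda>x. x) (carrier ?K)" by simp
    with flat f K N show "inj_on (tensor_map R ?N M (\<lambda>x. x)) (carrier (tensor R ?K M))"
      unfolding flat_def by blast
    \<comment> \<open>The inclusion of \<open>I\<close> is the identity on representatives, so it
      leaves the formal sum unchanged.\<close>
    show "pair_map (\<lambda>x. x) u \<in> tensor_sub R ?N M"
      unfolding pair_map_ident u_def by (rule combination_tensor_sub[OF S r])
  qed
  \<comment> \<open>The coefficients are chosen without any compatibility. They may fail to be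
    linear in \<open>x\<close>, but only by syzygies of \<open>r\<close>.\<close>
  have "\<forall>x. \<exists>c. x \<in> I \<longrightarrow> c \<in> S \<rightarrow> carrier R \<and> x = (\<Oplus>s\<in>S. r s \<otimes> c s)"
    unfolding I_def by blast
  then obtain c where c_all: "\<forall>x. x \<in> I \<longrightarrow> c x \<in> S \<rightarrow> carrier R \<and> x = (\<Oplus>s\<in>S. r s \<otimes> c x s)"
    by (rule choice[THEN exE])
  have c: "c x s \<in> carrier R" if "x \<in> I" "s \<in> S" for x s
    using c_all that by auto
  have c_sum: "(\<Oplus>s\<in>S. r s \<otimes> c x s) = x" if "x \<in> I" for x
    using c_all that by simp
  let ?F = "tensor_free ?K M"
  have "\<forall>s. \<exists>h. s \<in> S \<longrightarrow> h \<in> hom ?F (add_monoid M) \<and>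
    (\<forall>x\<in>I. \<forall>m\<in>carrier M. h (frag_of ({[x]}, m)) = c x s \<odot>\<^bsub>M\<^esub> m)"
  proof
    fix s
    show "\<exists>h. s \<in> S \<longrightarrow> h \<in> hom ?F (add_monoid M) \<and>
      (\<forall>x\<in>I. \<forall>m\<in>carrier M. h (frag_of ({[x]}, m)) = c x s \<odot>\<^bsub>M\<^esub> m)"
    proof (cases "s \<in> S")
      case True
      have img: "(\<lambda>(w, m). c (hd (the_elem w)) s \<odot>\<^bsub>M\<^esub> m) ` (carrier ?K \<times> carrier M) \<subseteq> carrier (add_monoid M)"
        using c[OF _ True] by auto
      show ?thesis
      proof (rule comm_group.free_Abelian_group_universal[OF M.a_comm_group img])
        fix h
        assume "h \<in> hom ?F (add_monoid M)"
          "\<And>y. y \<in> carrier ?K \<times> carrier M \<Longrightarrow> h (frag_of y) = (\<lambda>(w, m). c (hd (the_elem w)) s \<odot>\<^bsub>M\<^esub> m) y"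
        then show ?thesis by (intro exI[of _ h]) auto
      qed
    qed simp
  qed
  then obtain h where "\<forall>s. s \<in> S \<longrightarrow> h s \<in> hom ?F (add_monoid M) \<and>
    (\<forall>x\<in>I. \<forall>m\<in>carrier M. h s (frag_of ({[x]}, m)) = c x s \<odot>\<^bsub>M\<^esub> m)"
    by (rule choice[THEN exE])
  then have h: "\<And>s. s \<in> S \<Longrightarrow> h s \<in> hom ?F (add_monoid M)"
    "\<And>s x m. s \<in> S \<Longrightarrow> x \<in> I \<Longrightarrow> m \<in> carrier M \<Longrightarrow> h s (frag_of ({[x]}, m)) = c x s \<odot>\<^bsub>M\<^esub> m"
    by blast+
  have h_diff: "h s (v - w) = h s v \<ominus>\<^bsub>M\<^esub> h s w"
    if "s \<in> S" "v \<in> carrier ?F" "w \<in> carrier ?F" for s v w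
    using comm_group.hom_free_Abelian_group_diff[OF M.a_comm_group h(1) that(2,3)] that(1)
    by (simp add: a_inv_def a_minus_def)
  have h_zero: "h s 0 = \<zero>\<^bsub>M\<^esub>" if "s \<in> S" for s
    using hom_one[OF h(1)[OF that] group_free_Abelian_group M.a_group] by simp
  let ?P = "syzygy_combinations R M S r"
  \<comment> \<open>Formal sums whose image in M^S is a syzygy combination. As this is a subgroup,
    it contains \<open>tensor_sub R ?K M\<close>, and with it \<open>u\<close>, once it contains the
    defining relations.\<close>
  define Q where "Q = {v \<in> carrier ?F. (\<lambda>s. h s v) \<in> ?P}"
  have Q_diff: "v - w \<in> Q" if "v \<in> Q" "w \<in> Q" for v w
  proof -
    have vw: "v \<in> carrier ?F" "w \<in> carrier ?F" using that by (auto simp: Q_def)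
    have "(\<lambda>s. h s v \<ominus>\<^bsub>M\<^esub> h s w) \<in> ?P"
      using that by (intro syzygy_combinations_minus[OF S rc]) (auto simp: Q_def)
    then have "(\<lambda>s. h s (v - w)) \<in> ?P"
      by (rule syzygy_combinations_cong) (rule h_diff[symmetric, OF _ vw])
    moreover have "v - w \<in> carrier ?F" using vw keys_diff[of v w] by auto
    ultimately show ?thesis by (simp add: Q_def)
  qed
  have "(\<lambda>s. \<zero> \<odot>\<^bsub>M\<^esub> \<zero>\<^bsub>M\<^esub>) \<in> ?P"
  proof -
    obtain d where "d \<in> S \<rightarrow> carrier R" "\<zero>\<^bsub>M\<^esub> = (\<Oplus>\<^bsub>M\<^esub>s\<in>S. d s \<odot>\<^bsub>M\<^esub> s)" using gen[OF M.zero_closed] by blast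
    moreover have "(\<Oplus>s\<in>S. r s \<otimes> \<zero>) = (\<Oplus>s\<in>S. \<zero>)" using rc by (intro R.finsum_cong') auto
    ultimately show ?thesis
      using rc by (intro syzygy_combinations_smult[OF S, of r _ d]) (auto simp: R.finsum_zero)
  qed
  then have "(\<lambda>s. h s 0) \<in> ?P"
    by (rule syzygy_combinations_cong) (simp add: h_zero)
  then have Q_zero: "0 \<in> Q" by (simp add: Q_def)
  have Q_subgroup: "subgroup Q ?F"
  proof (rule group.subgroupI[OF group_free_Abelian_group])
    show "Q \<subseteq> carrier ?F" "Q \<noteq> {}" using Q_zero by (auto simp: Q_def)
    show "inv\<^bsub>?F\<^esub> v \<in> Q" if "v \<in> Q" for v
    proof -
      have "inv\<^bsub>?F\<^esub> v = 0 - v" using that by (simp add: Q_def)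
      then show ?thesis using Q_diff[OF Q_zero that] by (simp only:)
    qed
    show "v \<otimes>\<^bsub>?F\<^esub> w \<in> Q" if "v \<in> Q" "w \<in> Q" for v w
      using Q_diff[OF that(1) Q_diff[OF Q_zero that(2)]] by simp
  qed
  \<comment> \<open>The form in which each defining relation is treated: its image is a syzygy
    \<open>l\<close> of \<open>r\<close> multiplied by a single element \<open>m\<close>.\<close>
  have Q_I: "v \<in> Q" if v: "v \<in> carrier ?F" and m: "m \<in> carrier M"
    and l: "\<And>s. s \<in> S \<Longrightarrow> l s \<in> carrier R" "(\<Oplus>s\<in>S. r s \<otimes> l s) = \<zero>"
    and eq: "\<And>s. s \<in> S \<Longrightarrow> h s v = l s \<odot>\<^bsub>M\<^esub> m" for v m l
  proof -
    obtain d where d: "d \<in> S \<rightarrow> carrier R" "m = (\<Oplus>\<^bsub>M\<^esub>s\<in>S. d s \<odot>\<^bsub>M\<^esub> s)" using gen[OF m] by blast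
    have "(\<lambda>s. l s \<odot>\<^bsub>M\<^esub> m) \<in> ?P"
      using d l rc by (intro syzygy_combinations_smult[OF S, of r _ d]) auto
    then have "(\<lambda>s. h s v) \<in> ?P"
      by (rule syzygy_combinations_cong) (simp add: eq)
    then show ?thesis using v by (simp add: Q_def)
  qed
  have fc: "frag_of ({[x]}, m) \<in> carrier ?F" if "x \<in> I" "m \<in> carrier M" for x m
    using that by simp
  have fc2: "v - w \<in> carrier ?F" if "v \<in> carrier ?F" "w \<in> carrier ?F" for v w
    using that keys_diff[of v w] by auto
  have "tensor_rels R ?K M \<subseteq> Q"
  proof
    fix v assume "v \<in> tensor_rels R ?K M"
    then consider
        (add_left) x y m where "v = frag_of ({[x \<oplus> y]}, m) - frag_of ({[x]}, m) - frag_of ({[y]}, m)"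
          "x \<in> I" "y \<in> I" "m \<in> carrier M"
      | (add_right) x m m' where "v = frag_of ({[x]}, m \<oplus>\<^bsub>M\<^esub> m') - frag_of ({[x]}, m) - frag_of ({[x]}, m')"
          "x \<in> I" "m \<in> carrier M" "m' \<in> carrier M"
      | (smult) a x m where "v = frag_of ({[a \<otimes> x]}, m) - frag_of ({[x]}, a \<odot>\<^bsub>M\<^esub> m)"
          "a \<in> carrier R" "x \<in> I" "m \<in> carrier M"
      unfolding tensor_rels_def by auto
    then show "v \<in> Q"
    proof cases
      case add_left
      note v = add_left(1) and mem = add_left(2-4)
      have xy: "x \<oplus> y \<in> I"
        using additive_subgroup.a_closed[OF ideal.axioms(1)[OF I] mem(1,2)] .
      show ?thesis
      proof (rule Q_I[of v m "\<lambda>s. c (x \<oplus> y) s \<ominus> c x s \<ominus> c y s"])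
        show "v \<in> carrier ?F" unfolding v using xy mem by (intro fc2 fc)
        show "c (x \<oplus> y) s \<ominus> c x s \<ominus> c y s \<in> carrier R" if "s \<in> S" for s
          using c xy mem that by simp
        have "(\<Oplus>s\<in>S. r s \<otimes> (c (x \<oplus> y) s \<ominus> c x s \<ominus> c y s)) = x \<oplus> y \<ominus> x \<ominus> y"
          using rc c xy mem c_sum S by (simp add: R.finsum_mult_minus)
        also have "\<dots> = \<zero>" using Ic[OF mem(1)] Ic[OF mem(2)] by algebra
        finally show "(\<Oplus>s\<in>S. r s \<otimes> (c (x \<oplus> y) s \<ominus> c x s \<ominus> c y s)) = \<zero>" .
        show "h s v = (c (x \<oplus> y) s \<ominus> c x s \<ominus> c y s) \<odot>\<^bsub>M\<^esub> m" if s: "s \<in> S" for s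
          unfolding v using s xy mem c[OF _ s]
            h_diff[OF s fc2[OF fc[OF xy mem(3)] fc[OF mem(1,3)]] fc[OF mem(2,3)]]
            h_diff[OF s fc[OF xy mem(3)] fc[OF mem(1,3)]]
          by (simp add: h(2) smult_minus_distr)
      qed (use mem in auto)
    next
      case add_right
      note v = add_right(1) and mem = add_right(2-4)
      \<comment> \<open>In the second argument the \<open>h s\<close> are additive exactly, so the
        zero syzygy suffices.\<close>
      show ?thesis
      proof (rule Q_I[of v m "\<lambda>s. \<zero>"])
        show "v \<in> carrier ?F" unfolding v using mem by (intro fc2 fc M.a_closed)
        have "(\<Oplus>s\<in>S. r s \<otimes> \<zero>) = (\<Oplus>s\<in>S. \<zero>)" using rc by (intro R.finsum_cong') auto
        then show "(\<Oplus>s\<in>S. r s \<otimes> \<zero>) = \<zero>" by (simp add: R.finsum_zero)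
        show "h s v = \<zero> \<odot>\<^bsub>M\<^esub> m" if s: "s \<in> S" for s
        proof -
          define p q where "p = c x s \<odot>\<^bsub>M\<^esub> m" and "q = c x s \<odot>\<^bsub>M\<^esub> m'"
          have pq: "p \<in> carrier M" "q \<in> carrier M" using mem c[OF _ s] by (auto simp: p_def q_def)
          have "h s v = p \<oplus>\<^bsub>M\<^esub> q \<ominus>\<^bsub>M\<^esub> p \<ominus>\<^bsub>M\<^esub> q"
            unfolding v p_def q_def using s mem c[OF _ s]
              h_diff[OF s fc2[OF fc[OF mem(1) M.a_closed[OF mem(2,3)]] fc[OF mem(1,2)]] fc[OF mem(1,3)]]
              h_diff[OF s fc[OF mem(1) M.a_closed[OF mem(2,3)]] fc[OF mem(1,2)]]
            by (simp add: h(2) smult_r_distr)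
          also have "\<dots> = \<zero>\<^bsub>M\<^esub>"
            using pq M.r_neg[of "p \<oplus>\<^bsub>M\<^esub> q"] by (simp add: M.minus_eq M.minus_add M.a_assoc)
          finally show ?thesis using mem by simp
        qed
      qed (use mem in auto)
    next
      case smult
      note v = smult(1) and mem = smult(2-4)
      have ax: "a \<otimes> x \<in> I" using ideal.I_l_closed[OF I mem(2,1)] .
      show ?thesis
      proof (rule Q_I[of v m "\<lambda>s. c (a \<otimes> x) s \<ominus> c x s \<otimes> a"])
        show "v \<in> carrier ?F" unfolding v using ax mem by (intro fc2 fc smult_closed)
        show "c (a \<otimes> x) s \<ominus> c x s \<otimes> a \<in> carrier R" if "s \<in> S" for s
          using c ax mem that by simp
        have "(\<Oplus>s\<in>S. r s \<otimes> (c x s \<otimes> a)) = (\<Oplus>s\<in>S. r s \<otimes> c x s \<otimes> a)"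
          using rc c mem by (intro R.finsum_cong') (auto simp: R.m_assoc)
        also have "\<dots> = x \<otimes> a"
          using rc c mem S c_sum by (simp add: R.finsum_ldistr[symmetric] Pi_iff)
        finally have "(\<Oplus>s\<in>S. r s \<otimes> (c (a \<otimes> x) s \<ominus> c x s \<otimes> a)) = a \<otimes> x \<ominus> x \<otimes> a"
          using rc c ax mem c_sum S by (simp add: R.finsum_mult_minus)
        also have "\<dots> = \<zero>" using Ic[OF mem(2)] mem(1) by algebra
        finally show "(\<Oplus>s\<in>S. r s \<otimes> (c (a \<otimes> x) s \<ominus> c x s \<otimes> a)) = \<zero>" .
        show "h s v = (c (a \<otimes> x) s \<ominus> c x s \<otimes> a) \<odot>\<^bsub>M\<^esub> m" if s: "s \<in> S" for s
          unfolding v using s ax mem c[OF _ s]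
            h_diff[OF s fc[OF ax mem(3)] fc[OF mem(2) smult_closed[OF mem(1,3)]]]
          by (simp add: h(2) smult_minus_distr smult_assoc1)
      qed (use mem in auto)
    qed
  qed
  then have "tensor_sub R ?K M \<subseteq> Q"
    unfolding tensor_sub_def
    by (rule group.generate_subgroup_incl[OF group_free_Abelian_group _ Q_subgroup])
  then have uP: "(\<lambda>s. h s u) \<in> ?P" using u by (auto simp: Q_def)
  have h_sum: "h s (\<Sum>t\<in>A. frag_of ({[r t]}, t)) = (\<Oplus>\<^bsub>M\<^esub>t\<in>A. c (r t) s \<odot>\<^bsub>M\<^esub> t)"
    if s: "s \<in> S" and A: "A \<subseteq> S" for s A
    using finite_subset[OF A S(1)] A
  proof (induction A rule: finite_induct)
    case empty
    then show ?case using h_zero[OF s] by simp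
  next
    case (insert j A)
    have j: "j \<in> S" "j \<in> carrier M" using insert.prems S by auto
    have sum: "(\<Sum>t\<in>A. frag_of ({[r t]}, t)) \<in> carrier ?F"
      using insert.prems S rI by (intro sum_closed_free_Abelian_group) auto
    have "h s (\<Sum>t\<in>insert j A. frag_of ({[r t]}, t))
        = h s (frag_of ({[r j]}, j) \<otimes>\<^bsub>?F\<^esub> (\<Sum>t\<in>A. frag_of ({[r t]}, t)))"
      using insert.hyps by simp
    also have "\<dots> = h s (frag_of ({[r j]}, j)) \<oplus>\<^bsub>M\<^esub> h s (\<Sum>t\<in>A. frag_of ({[r t]}, t))"
      using hom_mult[OF h(1)[OF s] fc[OF rI[OF j(1)] j(2)] sum] by simp
    also have "\<dots> = c (r j) s \<odot>\<^bsub>M\<^esub> j \<oplus>\<^bsub>M\<^esub> (\<Oplus>\<^bsub>M\<^esub>t\<in>A. c (r t) s \<odot>\<^bsub>M\<^esub> t)"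
      using insert h(2)[OF s rI[OF j(1)] j(2)] by simp
    also have "\<dots> = (\<Oplus>\<^bsub>M\<^esub>t\<in>insert j A. c (r t) s \<odot>\<^bsub>M\<^esub> t)"
      using insert S rI c s j by (subst M.finsum_insert) (auto simp: subset_iff)
    finally show ?case .
  qed
  \<comment> \<open>Entry \<open>s\<close> of the image of \<open>u\<close> is the combination of
    the generators \<open>t\<close> with coefficients \<open>c (r t) s\<close>, and
    \<open>?b\<close> measures its distance from \<open>s\<close>. Column \<open>t\<close> of
    \<open>?b\<close> is a syzygy because \<open>c (r t)\<close> and the unit vector at
    \<open>t\<close> both express \<open>r t\<close> through \<open>r\<close>.\<close>
  let ?b = "\<lambda>s t. c (r t) s \<ominus> (if s = t then \<one> else \<zero>)"
  have "(\<lambda>s. \<Oplus>\<^bsub>M\<^esub>t\<in>S. ?b s t \<odot>\<^bsub>M\<^esub> t) \<in> ?P"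
  proof (rule syzygy_combinationsI[where b = ?b])
    fix t assume t: "t \<in> S"
    have "(\<Oplus>s\<in>S. r s \<otimes> (if s = t then \<one> else \<zero>)) = r t"
      using delta[OF t] by (simp add: eq_commute)
    then have "row_mult R S r ?b t = r t \<ominus> r t"
      unfolding row_mult_def using rc c rI t c_sum S by (simp add: R.finsum_mult_minus)
    then show "row_mult R S r ?b t = \<zero>" using rc[OF t] by (simp add: R.minus_eq R.r_neg)
  qed (use c rI in auto)
  from syzygy_combinations_minus[OF S rc uP this] show ?thesis
  proof (rule syzygy_combinations_cong)
    fix s assume s: "s \<in> S"
    define w where "w = (\<Oplus>\<^bsub>M\<^esub>t\<in>S. c (r t) s \<odot>\<^bsub>M\<^esub> t)"
    have w: "w \<in> carrier M" unfolding w_def using S c rI s by (intro combination_closed) auto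
    have "(\<Oplus>\<^bsub>M\<^esub>t\<in>S. ?b s t \<odot>\<^bsub>M\<^esub> t) = w \<ominus>\<^bsub>M\<^esub> s"
      unfolding w_def using S c rI s combination_delta[OF S s]
      by (subst combination_minus) auto
    moreover have "h s u = w" unfolding u_def w_def using s by (intro h_sum) auto
    moreover have "w \<ominus>\<^bsub>M\<^esub> (w \<ominus>\<^bsub>M\<^esub> s) = s"
      using w s S by (simp add: M.minus_eq M.minus_add M.r_neg1 M.r_neg2 subset_iff)
    ultimately show "h s u \<ominus>\<^bsub>M\<^esub> (\<Oplus>\<^bsub>M\<^esub>t\<in>S. ?b s t \<odot>\<^bsub>M\<^esub> t) = s" by simp
  qed
qed

end

text \<open>Take 1 - b for the matrix \<open>b\<close> of the equational criterion: its rows are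
  relations because \<open>b\<close> reproduces every generator, and it fixes \<open>k\<close>
  because \<open>k\<close> annihilates \<open>b\<close>.\<close>

lemma (in module) flat_imp_pure:
  assumes S: "finite S" "S \<subseteq> carrier M"
    and gen: "\<And>x. x \<in> carrier M \<Longrightarrow> \<exists>c\<in>S \<rightarrow> carrier R. x = (\<Oplus>\<^bsub>M\<^esub>s\<in>S. c s \<odot>\<^bsub>M\<^esub> s)"
    and flat: "flat TYPE('a list set) R M" and k: "k \<in> relations R M S"
  shows "\<exists>a\<in>S \<rightarrow> relations R M S. \<forall>t\<in>S. k t = row_mult R S k a t"
proof -
  have kc: "k s \<in> carrier R" if "s \<in> S" for s using k that by (simp add: relations_def)
  obtain b where b: "\<And>s t. s \<in> S \<Longrightarrow> t \<in> S \<Longrightarrow> b s t \<in> carrier R"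
    "\<And>t. t \<in> S \<Longrightarrow> row_mult R S k b t = \<zero>" "\<And>s. s \<in> S \<Longrightarrow> s = (\<Oplus>\<^bsub>M\<^esub>t\<in>S. b s t \<odot>\<^bsub>M\<^esub> t)"
    using flat_syzygies[OF assms] unfolding syzygy_combinations_def by blast
  let ?a = "\<lambda>s t. (if s = t then \<one> else \<zero>) \<ominus> b s t"
  have "?a s \<in> relations R M S" if s: "s \<in> S" for s
    using combination_delta[OF S s] b(3)[OF s] by (intro relations_minus[OF S]) (auto simp: b(1) s)
  moreover have "k t = row_mult R S k ?a t" if t: "t \<in> S" for t
  proof -
    have "row_mult R S k ?a t = (\<Oplus>s\<in>S. k s \<otimes> (if s = t then \<one> else \<zero>)) \<ominus> row_mult R S k b t"
      unfolding row_mult_def using S kc b(1) t by (intro R.finsum_mult_minus) auto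
    also have "(\<Oplus>s\<in>S. k s \<otimes> (if s = t then \<one> else \<zero>)) = (\<Oplus>s\<in>S. if t = s then k s else \<zero>)"
      using kc by (intro R.finsum_cong') auto
    also have "\<dots> = k t" using kc t S by (intro R.add.finprod_singleton) auto
    finally show ?thesis using b(2)[OF t] kc[OF t] by (simp add: R.minus_eq)
  qed
  ultimately show ?thesis by (intro bexI[of _ ?a]) auto
qed

theorem theorem3p11:
  fixes R :: "('a, 'r) ring_scheme" and Y :: "'a set set"
  assumes "cring R"
    and "Y \<subseteq> Spec R"
    and "\<And>m. maximalideal m R \<Longrightarrow> \<exists>p\<in>Y. p \<subseteq> m"
    and "acc {Y \<inter> V R f | f. f \<in> carrier R} \<or> dcc {Y \<inter> V R f | f. f \<in> carrier R}"
  shows "S_ring TYPE('m) TYPE('n) R"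
  unfolding S_ring_def
proof (intro conjI allI impI, rule assms(1), elim conjE)
  fix M :: "('a, 'm) module"
  assume M: "module R M" and fg: "fin_gen R M" and flat: "flat TYPE('a list set) R M"
  interpret M: module R M by fact
  obtain S where S: "finite S" "S \<subseteq> carrier M"
    and gen: "\<And>x. x \<in> carrier M \<Longrightarrow> \<exists>c\<in>S \<rightarrow> carrier R. x = (\<Oplus>\<^bsub>M\<^esub>s\<in>S. c s \<odot>\<^bsub>M\<^esub> s)"
    using fg unfolding fin_gen_def by blast
  interpret K: pure_relations R S "relations R M S"
    by (rule M.pure_relations_relations[OF S M.flat_imp_pure[OF S gen flat]])
  obtain a where a: "a \<in> S \<rightarrow> relations R M S"
    "\<And>k t. k \<in> relations R M S \<Longrightarrow> t \<in> S \<Longrightarrow> k t = row_mult R S k a t"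
    using K.exists_projection[OF assms(2-4)] by blast
  show "projective TYPE('n) R M"
    by (rule M.projective_if_relations_projection[OF S gen a])
qed

end
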